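(* Let $\mathcal{H}$ be a finite-dimensional complex Hilbert space and $p\in[1,\infty)$. For a distance $d$ on the set $\mathbf{P}_{\mathcal{H}}$ of pure states, let $D_p$ be the associated quantum folded Wasserstein-$p$ pseudo-distance on the set $\mathfrak{S}_{\mathcal{H}}$ of density matrices. (a) For the Frobenius distance $$d^{\mathrm{Fr}}(P_\psi,P_\phi)=\sqrt2\,\sqrt{1-|\langle\psi|\phi\rangle|^2}=\|P_\psi-P_\phi\|_{\mathrm{Fr}},$$ the associated $D^{\mathrm{Fr}}_p$ is a distance on $\mathfrak{S}_{\mathcal{H}}$ whose induced topology is equivalent to the natural topology; it extends $d^{\mathrm{Fr}}$, i.e. $D^{\mathrm{Fr}}_p=d^{\mathrm{Fr}}$ on $\mathbf{P}_{\mathcal{H}}\times\mathbf{P}_{\mathcal{H}}$; and it dominates the Frobenius norm, i.e. $D^{\mathrm{Fr}}_p(\rho,\sigma)\ge\|\rho-\sigma\|_{\mathrm{Fr}}$ for all $\rho,\sigma\in\mathfrak{S}_{\mathcal{H}}$. Moreover $(\mathfrak{S}_{\mathcal{H}},D^{\mathrm{Fr}}_1)$ is geodesic. (b) For the Fubini–Study distance $$d^{\mathrm{FS}}(P_\psi,P_\phi)=\arccos|\langle\psi|\phi\rangle|,$$ the associated $D^{\mathrm{FS}}_p$ is a distance on $\mathfrak{S}_{\mathcal{H}}$ whose induced topology is equivalent to the natural topology; it sub-extends $d^{\mathrm{FS}}$, i.e. $D^{\mathrm{FS}}_p\le d^{\mathrm{FS}}$ on $\mathbf{P}_{\mathcal{H}}\times\mathbf{P}_{\mathcal{H}}$;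 and it dominates $2^{-1/2}\|\cdot\|_{\mathrm{Fr}}$, i.e. $D^{\mathrm{FS}}_p(\rho,\sigma)\ge2^{-1/2}\|\rho-\sigma\|_{\mathrm{Fr}}$ for all $\rho,\sigma\in\mathfrak{S}_{\mathcal{H}}$. Moreover $(\mathfrak{S}_{\mathcal{H}},D^{\mathrm{FS}}_p)$ is geodesic for every $p\ge1$.
   Context: $\mathfrak{S}_{\mathcal{H}}$ is the set of positive semidefinite self-adjoint operators on $\mathcal{H}$ of trace one; $\mathbf{P}_{\mathcal{H}}=\{P_\psi:\psi\in\mathcal{H},\langle\psi|\psi\rangle=1\}$ is the set of rank-one orthogonal projectors $P_\psi:\phi\mapsto\langle\psi|\phi\rangle\psi$. $\mathcal{P}(E)$ denotes the Radon probability measures on $E$. The natural topology is the norm topology of $\mathcal{B}(\mathcal{H})$, and $\|A\|_{\mathrm{Fr}}=\mathrm{Tr}(AA^\dagger)^{1/2}$. For $\rho\in\mathfrak{S}_{\mathcal{H}}$, $\mathcal{P}_\rho=\{\mu\in\mathcal{P}(\mathbf{P}_{\mathcal{H}}):\int P\,d\mu(P)=\rho\}$. $W_p$ is the Wasserstein-$p$ distance on $\mathcal{P}(\mathbf{P}_{\mathcal{H}})$ built from $(\mathbf{P}_{\mathcal{H}},d)$. Set $$d_{*p}(\rho,\sigma)=\inf_{\mu\in\mathcal{P}_\rho}\inf_{\nu\in\mathcal{P}_\sigma}W_p(\mu,\nu),$$ $$D_p(\rho,\sigma)=\inf\Big\{\sum_{n=1}^N d_{*p}(\gamma_n,\gamma_{n+1}):\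 N\ge1,\ \gamma_1=\rho,\ \gamma_{N+1}=\sigma,\ \gamma_n\in\mathfrak{S}_{\mathcal{H}}\Big\}.$$ A metric space is geodesic if any two of its points are joined by a constant-speed geodesic, i.e. a curve $(x_t)_{t\in[0,1]}$ with distance between $x_s$ and $x_t$ equal to $|t-s|$ times the distance between $x_0$ and $x_1$. *)

theory Defs
  imports "HOL-Probability.Probability_Measure"
begin

section \<open>Finite-dimensional complex Hilbert spaces\<close>

text \<open>
  A type of this class is a nonzero finite-dimensional complex Hilbert space: the superclass
  \<^class>\<open>euclidean_space\<close> supplies the underlying real inner product space, its finite dimension
  and its norm, and the real inner product is the real part of the complex one. The complex inner
  product is linear in the second argument, as in the bra-ket notation. (On the zero space there
  are no density operators.)
\<close>

class fd_complex_hilbert = euclidean_space +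
  fixes scaleC :: "complex \<Rightarrow> 'a \<Rightarrow> 'a"  (infixr \<open>*\<^sub>C\<close> 75)
    and cinner :: "'a \<Rightarrow> 'a \<Rightarrow> complex"
  assumes scaleC_add_right: "a *\<^sub>C (x + y) = a *\<^sub>C x + a *\<^sub>C y"
    and scaleC_add_left: "(a + b) *\<^sub>C x = a *\<^sub>C x + b *\<^sub>C x"
    and scaleC_scaleC: "a *\<^sub>C (b *\<^sub>C x) = (a * b) *\<^sub>C x"
    and scaleC_of_real: "of_real r *\<^sub>C x = r *\<^sub>R x"
    and cinner_commute: "cinner x y = cnj (cinner y x)"
    and cinner_add_right: "cinner x (y + z) = cinner x y + cinner x z"
    and cinner_scaleC_right: "cinner x (a *\<^sub>C y) = a * cinner x y"
    and inner_eq_Re_cinner: "inner x y = Re (cinner x y)"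

instantiation complex :: fd_complex_hilbert
begin

definition scaleC_complex :: "complex \<Rightarrow> complex \<Rightarrow> complex"
  where "scaleC_complex a x = a * x"

definition cinner_complex :: "complex \<Rightarrow> complex \<Rightarrow> complex"
  where "cinner_complex x y = cnj x * y"

instance
  by standard
    (auto simp: scaleC_complex_def cinner_complex_def algebra_simps scaleR_conv_of_real
      inner_complex_def)

end

text \<open>In particular \<^typ>\<open>complex ^ 'n\<close> is an instance, with its standard inner product.\<close>

instantiation vec :: (fd_complex_hilbert, finite) fd_complex_hilbert
begin

definition scaleC_vec :: "complex \<Rightarrow> 'a ^ 'b \<Rightarrow> 'a ^ 'b"
  where "scaleC_vec a x = (\<chi> i. a *\<^sub>C (x $ i))"

definition cinner_vec :: "'a ^ 'b \<Rightarrow> 'a ^ 'b \<Rightarrow> complex"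
  where "cinner_vec x y = (\<Sum>i\<in>UNIV. cinner (x $ i) (y $ i))"

instance
proof
  fix x y :: "'a ^ 'b"
  show "cinner x y = cnj (cinner y x)"
    unfolding cinner_vec_def cnj_sum by (intro sum.cong refl cinner_commute)
qed (auto simp: scaleC_vec_def cinner_vec_def vec_eq_iff scaleC_add_right scaleC_add_left
    scaleC_scaleC scaleC_of_real cinner_add_right cinner_scaleC_right sum.distrib
    sum_distrib_left inner_vec_def inner_eq_Re_cinner)

end


section \<open>Operators\<close>

text \<open>
  Operators are elements of the type \<^typ>\<open>'a \<Rightarrow>\<^sub>L 'a\<close>, whose norm is the operator norm; this type
  consists of the real-linear maps, so complex linearity is imposed separately.
\<close>

definition clinear_op :: "('a::fd_complex_hilbert \<Rightarrow>\<^sub>L 'a) \<Rightarrow> bool"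
  where "clinear_op A \<longleftrightarrow> (\<forall>a x. blinfun_apply A (a *\<^sub>C x) = a *\<^sub>C blinfun_apply A x)"

definition orthonormal_basis :: "'a::fd_complex_hilbert set \<Rightarrow> bool"
  where "orthonormal_basis B \<longleftrightarrow>
    finite B \<and>
    (\<forall>e\<in>B. \<forall>f\<in>B. cinner e f = (if e = f then 1 else 0)) \<and>
    (\<forall>x. \<exists>c. x = (\<Sum>e\<in>B. c e *\<^sub>C e))"

definition op_trace :: "('a::fd_complex_hilbert \<Rightarrow>\<^sub>L 'a) \<Rightarrow> complex"
  where "op_trace A = (\<Sum>e\<in>(SOME B. orthonormal_basis B). cinner e (blinfun_apply A e))"

definition op_adjoint :: "('a::fd_complex_hilbert \<Rightarrow>\<^sub>L 'a) \<Rightarrow> ('a \<Rightarrow>\<^sub>L 'a)"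
  where "op_adjoint A =
    (THE B. \<forall>x y. cinner (blinfun_apply A x) y = cinner x (blinfun_apply B y))"

definition frobenius_norm :: "('a::fd_complex_hilbert \<Rightarrow>\<^sub>L 'a) \<Rightarrow> real"
  where "frobenius_norm A = sqrt (Re (op_trace (A o\<^sub>L op_adjoint A)))"

definition self_adjoint :: "('a::fd_complex_hilbert \<Rightarrow>\<^sub>L 'a) \<Rightarrow> bool"
  where "self_adjoint A \<longleftrightarrow>
    (\<forall>x y. cinner (blinfun_apply A x) y = cinner x (blinfun_apply A y))"

text \<open>For self-adjoint \<open>A\<close> the number \<open>\<langle>x|A x\<rangle>\<close> is real, so \<^const>\<open>Re\<close> loses nothing below.\<close>

definition density_ops :: "('a::fd_complex_hilbert \<Rightarrow>\<^sub>L 'a) set"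
  where "density_ops = {\<rho>. clinear_op \<rho> \<and> self_adjoint \<rho> \<and>
    (\<forall>x. 0 \<le> Re (cinner x (blinfun_apply \<rho> x))) \<and> op_trace \<rho> = 1}"

definition proj :: "'a::fd_complex_hilbert \<Rightarrow> ('a \<Rightarrow>\<^sub>L 'a)"
  where "proj \<psi> = Blinfun (\<lambda>\<phi>. cinner \<psi> \<phi> *\<^sub>C \<psi>)"

lemma blinfun_apply_proj: "blinfun_apply (proj \<psi>) \<phi> = cinner \<psi> \<phi> *\<^sub>C \<psi>"
proof -
  have "linear (\<lambda>\<phi>. cinner \<psi> \<phi> *\<^sub>C \<psi>)"
  proof (rule linearI)
    fix x y :: 'a and r :: real
    show "cinner \<psi> (x + y) *\<^sub>C \<psi> = cinner \<psi> x *\<^sub>C \<psi> + cinner \<psi> y *\<^sub>C \<psi>"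
      by (simp add: cinner_add_right scaleC_add_left)
    have "cinner \<psi> (r *\<^sub>R x) = of_real r * cinner \<psi> x"
      by (simp flip: scaleC_of_real add: cinner_scaleC_right)
    then show "cinner \<psi> (r *\<^sub>R x) *\<^sub>C \<psi> = r *\<^sub>R (cinner \<psi> x *\<^sub>C \<psi>)"
      by (simp flip: scaleC_of_real add: scaleC_scaleC)
  qed
  then show ?thesis
    by (simp add: proj_def bounded_linear_Blinfun_apply linear_conv_bounded_linear)
qed

definition pure_states :: "('a::fd_complex_hilbert \<Rightarrow>\<^sub>L 'a) set"
  where "pure_states = {proj \<psi> | \<psi>. cinner \<psi> \<psi> = 1}"

text \<open>Needed for Bochner integrals of operator-valued functions.\<close>

instance blinfun :: (euclidean_space, euclidean_space) second_countable_topology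
proof
  let ?K = "\<lambda>n::nat. cball (0 :: 'a \<Rightarrow>\<^sub>L 'b) (real n)"
  have "\<exists>k. finite k \<and> ?K n \<subseteq> (\<Union>x\<in>k. ball x (inverse (real (Suc m))))" for n m
  proof -
    have "compact (?K n)"
      by (rule compact_cball)
    then have "\<forall>\<epsilon>>0. \<exists>k. finite k \<and> ?K n \<subseteq> (\<Union>x\<in>k. ball x \<epsilon>)"
      by (subst (asm) compact_eq_totally_bounded) blast
    then show ?thesis
      by simp
  qed
  then obtain k where fin: "\<And>n m. finite (k n m)"
    and cov: "\<And>n m. ?K n \<subseteq> (\<Union>x\<in>k n m. ball x (inverse (real (Suc m))))"
    by metis
  define B where "B = (\<Union>n m. (\<lambda>x. ball x (inverse (real (Suc m)))) ` k n m)"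
  have "countable B"
    unfolding B_def by (auto intro: countable_finite[OF finite_imageI[OF fin]])
  moreover have "topological_basis B"
  proof (rule topological_basisI)
    fix U and x :: "'a \<Rightarrow>\<^sub>L 'b"
    assume "open U" "x \<in> U"
    then obtain e where e: "e > 0" "ball x e \<subseteq> U"
      using open_contains_ball by blast
    obtain m where m: "inverse (real (Suc m)) < e / 2"
      using reals_Archimedean[of "e / 2"] e by auto
    obtain n where "norm x \<le> real n"
      using real_arch_simple by blast
    then have "x \<in> ?K n"
      by simp
    then obtain y where y: "y \<in> k n m" "x \<in> ball y (inverse (real (Suc m)))"
      using cov[of n m] by blast
    have "ball y (inverse (real (Suc m))) \<subseteq> ball x e"
    proof
      fix z assume "z \<in> ball y (inverse (real (Suc m)))"
      then have "dist y z < e / 2" "dist y x < e / 2"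
        using y m by auto
      then show "z \<in> ball x e"
        using dist_triangle2[of x z y] by (simp add: dist_commute)
    qed
    then show "\<exists>b\<in>B. x \<in> b \<and> b \<subseteq> U"
      using y e unfolding B_def by (intro bexI[of _ "ball y (inverse (real (Suc m)))"]) auto
  qed (auto simp: B_def)
  ultimately show "\<exists>B::('a \<Rightarrow>\<^sub>L 'b) set set. countable B \<and> open = generate_topology B"
    using topological_basis_imp_subbasis by blast
qed


section \<open>Wasserstein distances\<close>

definition radon_prob :: "'a::topological_space set \<Rightarrow> 'a measure set"
  where "radon_prob E = {\<mu>. prob_space \<mu> \<and> sets \<mu> = sets (restrict_space borel E) \<and>
    (\<forall>A\<in>sets \<mu>. emeasure \<mu> A = (SUP K\<in>{K. K \<subseteq> A \<and> compact K}. emeasure \<mu> K))}"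

definition couplings ::
    "'a::topological_space set \<Rightarrow> 'a measure \<Rightarrow> 'a measure \<Rightarrow> ('a \<times> 'a) measure set"
  where "couplings E \<mu> \<nu> = {\<pi> \<in> radon_prob (E \<times> E).
    distr \<pi> (restrict_space borel E) fst = \<mu> \<and> distr \<pi> (restrict_space borel E) snd = \<nu>}"

text \<open>
  The cost is a Bochner integral, which is the intended transport cost when \<open>d\<close> is bounded and
  Borel measurable on \<open>E \<times> E\<close>; both distances used below are continuous on a compact set.
\<close>

definition wasserstein ::
    "'a::topological_space set \<Rightarrow> ('a \<Rightarrow> 'a \<Rightarrow> real) \<Rightarrow> real \<Rightarrow> 'a measure \<Rightarrow> 'a measure \<Rightarrow> real"
  where "wasserstein E d p \<mu> \<nu> =
    (INF \<pi>\<in>couplings E \<mu> \<nu>. (\<integral>z. d (fst z) (snd z) powr p \<partial>\<pi>) powr (1 / p))"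


section \<open>The quantum folded Wasserstein pseudo-distance\<close>

definition pure_decomps :: "('a::fd_complex_hilbert \<Rightarrow>\<^sub>L 'a) \<Rightarrow> ('a \<Rightarrow>\<^sub>L 'a) measure set"
  where "pure_decomps \<rho> = {\<mu> \<in> radon_prob pure_states. (\<integral>P. P \<partial>\<mu>) = \<rho>}"

definition d_star :: "(('a::fd_complex_hilbert \<Rightarrow>\<^sub>L 'a) \<Rightarrow> ('a \<Rightarrow>\<^sub>L 'a) \<Rightarrow> real) \<Rightarrow> real \<Rightarrow>
    ('a \<Rightarrow>\<^sub>L 'a) \<Rightarrow> ('a \<Rightarrow>\<^sub>L 'a) \<Rightarrow> real"
  where "d_star d p \<rho> \<sigma> =
    (INF \<mu>\<in>pure_decomps \<rho>. INF \<nu>\<in>pure_decomps \<sigma>. wasserstein pure_states d p \<mu> \<nu>)"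

text \<open>
  The value off the density operators is irrelevant; it is set to \<open>0\<close> because
  \<^locale>\<open>Metric_space\<close> asks for nonnegativity on the whole type.
\<close>

definition folded_dist :: "(('a::fd_complex_hilbert \<Rightarrow>\<^sub>L 'a) \<Rightarrow> ('a \<Rightarrow>\<^sub>L 'a) \<Rightarrow> real) \<Rightarrow> real \<Rightarrow>
    ('a \<Rightarrow>\<^sub>L 'a) \<Rightarrow> ('a \<Rightarrow>\<^sub>L 'a) \<Rightarrow> real"
  where "folded_dist d p \<rho> \<sigma> =
    (if \<rho> \<in> density_ops \<and> \<sigma> \<in> density_ops
     then Inf {(\<Sum>n=1..N. d_star d p (\<gamma> n) (\<gamma> (n + 1))) | (N::nat) \<gamma>.
            1 \<le> N \<and> \<gamma> 1 = \<rho> \<and> \<gamma> (N + 1) = \<sigma> \<and> (\<forall>n\<in>{1..N + 1}. \<gamma> n \<in> density_ops)}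
     else 0)"


section \<open>Distances on pure states\<close>

text \<open>
  A pure state determines its unit vector only up to a phase, which the modulus
  \<open>\<bar>\<langle>\<psi>|\<phi>\<rangle>\<bar>\<close> does not see.
\<close>

definition state_vec :: "('a::fd_complex_hilbert \<Rightarrow>\<^sub>L 'a) \<Rightarrow> 'a"
  where "state_vec P = (SOME \<psi>. cinner \<psi> \<psi> = 1 \<and> proj \<psi> = P)"

definition d_Fr :: "('a::fd_complex_hilbert \<Rightarrow>\<^sub>L 'a) \<Rightarrow> ('a \<Rightarrow>\<^sub>L 'a) \<Rightarrow> real"
  where "d_Fr P Q = sqrt 2 * sqrt (1 - (cmod (cinner (state_vec P) (state_vec Q)))\<^sup>2)"

definition d_FS :: "('a::fd_complex_hilbert \<Rightarrow>\<^sub>L 'a) \<Rightarrow> ('a \<Rightarrow>\<^sub>L 'a) \<Rightarrow> real"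
  where "d_FS P Q = arccos (cmod (cinner (state_vec P) (state_vec Q)))"


section \<open>Geodesic metric spaces\<close>

definition geodesic_space :: "'a set \<Rightarrow> ('a \<Rightarrow> 'a \<Rightarrow> real) \<Rightarrow> bool"
  where "geodesic_space M d \<longleftrightarrow>
    Metric_space M d \<and>
    (\<forall>a\<in>M. \<forall>b\<in>M. \<exists>x::real \<Rightarrow> 'a.
      (\<forall>t\<in>{0..1}. x t \<in> M) \<and> x 0 = a \<and> x 1 = b \<and>
      (\<forall>s\<in>{0..1}. \<forall>t\<in>{0..1}. d (x s) (x t) = \<bar>t - s\<bar> * d (x 0) (x 1)))"

end

theory Submission
  imports Defs
begin

text \<open>
  A positive operator is a nonnegative combination of pure states, so every density operator has
  finitely supported decompositions. Restricting to finitely supported couplings, the triples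
  (\<open>\<rho>\<close>, \<open>\<sigma>\<close>, transport cost) form a convex hull, and a general coupling lies in its closure.
  Convexity gives the upper bound by mixing: \<open>\<rho>\<close> and \<open>\<sigma>\<close> have a common mixture in which the
  admixed states have weight \<open>O(\<parallel>\<rho> - \<sigma>\<parallel>)\<close>, hence \<open>D\<^sub>p(\<rho>, \<sigma>) = O(\<parallel>\<rho> - \<sigma>\<parallel>\<^bsup>1/p\<^esup>)\<close>. The lower
  bound comes from linearizing \<open>x\<^sup>p\<close> and pairing with \<open>\<rho> - \<sigma>\<close> in the Frobenius inner product.

  For geodesics, each finitely supported plan is moved along a curve: along geodesics between the
  pure states for the Fubini-Study distance, and along the segment of mixtures for \<open>p = 1\<close>, where
  the cost is linear in the weights. Concatenating over a nearly optimal chain yields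
  almost-geodesics from \<open>\<rho>\<close> to \<open>\<sigma>\<close>, and compactness of the set of density operators yields a geodesic.
\<close>

section \<open>Complex inner products\<close>

text \<open>\<open>d_star\<close> need not satisfy the triangle inequality: the decomposition of a
  middle state that suits one link need not suit the next. Folding over chains restores it, so each
  estimate is proved for one link in a form that adds up along chains. The lower bound adds because
  \<open>hs_norm\<close> is a norm; approximate geodesics add because lengths and errors both do,
  the error per link being divided by the number of links. Finite support allows pure states to be
  moved without a measurable selection: one geodesic is chosen per atom. The price is that a plan
  approximating a coupling has ends near the given states, but not equal to them. The upper bound on
  the folded distance repairs this by two short jumps, so the approximate curves may be
  discontinuous. The Frobenius distance measures the chord and not the arc, so pure states are in
  general not joined by constant-speed curves for it; at p = 1 mass is moved in portions
  instead.\<close>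

lemma cinner_add_left: "cinner (x + y) z = cinner x z + cinner y (z::'a::fd_complex_hilbert)"
  by (metis cinner_add_right cinner_commute complex_cnj_add)

lemma cinner_scaleC_left: "cinner (a *\<^sub>C x) y = cnj a * cinner x (y::'a::fd_complex_hilbert)"
  by (metis cinner_commute cinner_scaleC_right complex_cnj_mult)

lemma cinner_zero_right [simp]: "cinner x (0::'a::fd_complex_hilbert) = 0"
  using cinner_add_right[of x 0 0] by simp

lemma cinner_zero_left [simp]: "cinner (0::'a::fd_complex_hilbert) x = 0"
  using cinner_add_left[of 0 0 x] by simp

lemma cinner_minus_right: "cinner x (- y) = - cinner x (y::'a::fd_complex_hilbert)"
  using cinner_add_right[of x y "-y"] by (simp add: add_eq_0_iff)

lemma cinner_minus_left: "cinner (- x) y = - cinner x (y::'a::fd_complex_hilbert)"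
  using cinner_add_left[of x "-x" y] by (simp add: add_eq_0_iff)

lemma cinner_diff_right: "cinner x (y - z) = cinner x y - cinner x (z::'a::fd_complex_hilbert)"
  using cinner_add_right[of x y "-z"] by (simp add: cinner_minus_right)

lemma cinner_diff_left: "cinner (x - y) z = cinner x z - cinner y (z::'a::fd_complex_hilbert)"
  using cinner_add_left[of x "-y" z] by (simp add: cinner_minus_left)

lemma cinner_sum_right: "cinner x (\<Sum>i\<in>I. f i) = (\<Sum>i\<in>I. cinner x (f i :: 'a::fd_complex_hilbert))"
  by (induction I rule: infinite_finite_induct) (auto simp: cinner_add_right)

lemma cinner_scaleR_right: "cinner x (r *\<^sub>R y) = of_real r * cinner x (y::'a::fd_complex_hilbert)"
  by (metis cinner_scaleC_right scaleC_of_real)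

lemma cinner_scaleR_left: "cinner (r *\<^sub>R x) y = of_real r * cinner x (y::'a::fd_complex_hilbert)"
  by (metis cinner_scaleC_left scaleC_of_real complex_cnj_complex_of_real)

lemma cinner_self: "cinner x x = of_real ((norm (x::'a::fd_complex_hilbert))\<^sup>2)"
proof -
  have "Im (cinner x x) = 0"
    using cinner_commute[of x x] by (simp add: complex_eq_iff)
  then show ?thesis
    by (simp add: complex_eq_iff power2_norm_eq_inner inner_eq_Re_cinner)
qed

lemma cinner_self_1_iff: "cinner x x = 1 \<longleftrightarrow> norm (x::'a::fd_complex_hilbert) = 1"
proof -
  have "cinner x x = 1 \<longleftrightarrow> (norm x)\<^sup>2 = 1\<^sup>2"
    by (simp add: cinner_self flip: of_real_power)
  then show ?thesis
    by (subst (asm) power2_eq_iff_nonneg) auto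
qed

lemma scaleC_0 [simp]: "(0::complex) *\<^sub>C (x::'a::fd_complex_hilbert) = 0"
  by (metis scaleC_of_real of_real_0 scaleR_zero_left)

lemma scaleC_1 [simp]: "(1::complex) *\<^sub>C (x::'a::fd_complex_hilbert) = x"
  by (metis scaleC_of_real of_real_1 scaleR_one)

lemma scaleC_zero_right [simp]: "a *\<^sub>C (0::'a::fd_complex_hilbert) = 0"
  using scaleC_add_right[of a 0 0] by simp

lemma scaleC_minus_left: "(- a) *\<^sub>C (x::'a::fd_complex_hilbert) = - (a *\<^sub>C x)"
  using scaleC_add_left[of a "-a" x] by (simp add: add_eq_0_iff)

lemma scaleC_minus_right: "a *\<^sub>C (- x::'a::fd_complex_hilbert) = - (a *\<^sub>C x)"
  using scaleC_add_right[of a x "-x"] by (simp add: add_eq_0_iff)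

lemma scaleC_diff_left: "(a - b) *\<^sub>C (x::'a::fd_complex_hilbert) = a *\<^sub>C x - b *\<^sub>C x"
  using scaleC_add_left[of a "-b" x] by (simp add: scaleC_minus_left)

lemma scaleC_diff_right: "a *\<^sub>C (x - y::'a::fd_complex_hilbert) = a *\<^sub>C x - a *\<^sub>C y"
  using scaleC_add_right[of a x "-y"] by (simp add: scaleC_minus_right)

lemma scaleC_scaleR: "a *\<^sub>C (r *\<^sub>R x) = r *\<^sub>R (a *\<^sub>C (x::'a::fd_complex_hilbert))"
  by (metis scaleC_of_real scaleC_scaleC mult.commute)

lemma norm_scaleC: "norm (a *\<^sub>C (x::'a::fd_complex_hilbert)) = cmod a * norm x"
proof -
  have "complex_of_real ((norm (a *\<^sub>C x))\<^sup>2) = (cnj a * a) * cinner x x"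
    unfolding cinner_self[symmetric] by (simp add: cinner_scaleC_left cinner_scaleC_right)
  also have "\<dots> = of_real ((cmod a * norm x)\<^sup>2)"
    by (simp add: cinner_self complex_norm_square power_mult_distrib mult.commute del: of_real_power)
  finally have "(norm (a *\<^sub>C x))\<^sup>2 = (cmod a * norm x)\<^sup>2"
    using of_real_eq_iff by blast
  then show ?thesis
    by (simp add: power2_eq_iff_nonneg)
qed

text \<open>A phase leaves the projector unchanged but makes an inner product real and nonnegative.
  This reduces complex Cauchy-Schwarz to the real one, and later aligns two state vectors before a
  great circle is drawn through them.\<close>

lemma cinner_phase:
  obtains u where "cmod u = 1" "cinner x (u *\<^sub>C (y::'a::fd_complex_hilbert)) = of_real (cmod (cinner x y))"
proof (cases "cinner x y = 0")
  case True
  then show thesis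
    using that[of 1] by simp
next
  case False
  define u where "u = of_real (cmod (cinner x y)) / cinner x y"
  have "cmod u = 1"
    using False by (simp add: u_def norm_divide)
  moreover have "cinner x (u *\<^sub>C y) = of_real (cmod (cinner x y))"
    using False by (simp add: u_def cinner_scaleC_right)
  ultimately show thesis
    by (rule that)
qed

lemma cmod_cinner_le: "cmod (cinner x y) \<le> norm x * norm (y::'a::fd_complex_hilbert)"
proof -
  obtain u where u: "cmod u = 1" "cinner x (u *\<^sub>C y) = of_real (cmod (cinner x y))"
    by (rule cinner_phase)
  then have "cmod (cinner x y) = inner x (u *\<^sub>C y)"
    by (simp add: inner_eq_Re_cinner)
  also have "\<dots> \<le> norm x * norm (u *\<^sub>C y)"
    by (rule norm_cauchy_schwarz)
  finally show ?thesis
    by (simp add: norm_scaleC u)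
qed

section \<open>Orthonormal bases and Parseval's identity\<close>

lemma cinner_eq_zero_imp: "(\<And>x. cinner x y = 0) \<Longrightarrow> (y::'a::fd_complex_hilbert) = 0"
  using cinner_self[of y] by simp

lemma cinner_orthonormal_sum:
  fixes B :: "'a::fd_complex_hilbert set"
  assumes "finite B" "\<And>e f. e \<in> B \<Longrightarrow> f \<in> B \<Longrightarrow> cinner e f = (if e = f then 1 else 0)" "e \<in> B"
  shows "cinner e (\<Sum>f\<in>B. c f *\<^sub>C f) = c e"
proof -
  have "cinner e (\<Sum>f\<in>B. c f *\<^sub>C f) = (\<Sum>f\<in>B. if e = f then c f else 0)"
    unfolding cinner_sum_right cinner_scaleC_right using assms by (intro sum.cong) auto
  then show ?thesis
    using assms by simp
qed

lemma orthonormal_basis_expansion: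
  assumes "orthonormal_basis B"
  shows "(x::'a::fd_complex_hilbert) = (\<Sum>e\<in>B. cinner e x *\<^sub>C e)"
proof -
  obtain c where c: "x = (\<Sum>e\<in>B. c e *\<^sub>C e)"
    using assms unfolding orthonormal_basis_def by blast
  have "cinner e x = c e" if "e \<in> B" for e
    unfolding c using assms that
    by (intro cinner_orthonormal_sum) (auto simp: orthonormal_basis_def)
  then show ?thesis
    using c by simp
qed

text \<open>An orthonormal family of greatest cardinality spans, since the normalized residual of an
  expansion would extend it. Cardinalities are bounded because complex orthonormality implies real
  orthogonality, hence real independence.\<close>

lemma orthonormal_basis_exists: "\<exists>B::'a::fd_complex_hilbert set. orthonormal_basis B"
proof -
  define on where "on B \<longleftrightarrow> finite B \<and> (\<forall>e\<in>B. \<forall>f\<in>B. cinner e f = (if e = f then 1 else 0))"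
    for B :: "'a set"
  have card: "card B \<le> DIM('a)" if "on B" for B
  proof -
    have "inner e f = (if e = f then 1 else 0)" if "e \<in> B" "f \<in> B" for e f
      using \<open>on B\<close> that by (auto simp: on_def inner_eq_Re_cinner)
    then have "pairwise orthogonal B" "0 \<notin> B"
      by (force simp: pairwise_def orthogonal_def)+
    then have "independent B"
      by (rule pairwise_orthogonal_independent)
    then show ?thesis
      by (simp add: independent_bound)
  qed
  have "on {}"
    by (simp add: on_def)
  then obtain B where B: "on B" "\<And>C. on C \<Longrightarrow> card C \<le> card B"
    using card ex_has_greatest_nat[of on "{}" card "Suc DIM('a)"] by (metis le_imp_less_Suc)
  have "\<exists>c. x = (\<Sum>e\<in>B. c e *\<^sub>C e)" for x
  proof (rule ccontr)
    assume neg: "\<nexists>c. x = (\<Sum>e\<in>B. c e *\<^sub>C e)"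
    define y where "y = x - (\<Sum>e\<in>B. cinner e x *\<^sub>C e)"
    have "y \<noteq> 0"
      using neg unfolding y_def by auto
    have ey: "cinner e y = 0" if "e \<in> B" for e
    proof -
      have "cinner e (\<Sum>f\<in>B. cinner f x *\<^sub>C f) = cinner e x"
        using B(1) that by (intro cinner_orthonormal_sum) (auto simp: on_def)
      then show ?thesis
        by (simp add: y_def cinner_diff_right)
    qed
    define z where "z = inverse (norm y) *\<^sub>R y"
    have z: "cinner z z = 1"
      using \<open>y \<noteq> 0\<close> by (simp add: z_def cinner_self_1_iff)
    have ez: "cinner e z = 0" "cinner z e = 0" if "e \<in> B" for e
      using ey[OF that] cinner_commute[of z e] by (auto simp: z_def cinner_scaleR_right)
    have "z \<notin> B"
      using ez(1)[of z] z by auto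
    have "on (insert z B)"
      using B(1) z ez \<open>z \<notin> B\<close> unfolding on_def by auto
    moreover have "card (insert z B) = Suc (card B)"
    proof (rule card_insert_disjoint[OF _ \<open>z \<notin> B\<close>])
      show "finite B"
        using B(1) unfolding on_def by blast
    qed
    ultimately show False
      using B(2)[of "insert z B"] by linarith
  qed
  then show ?thesis
    using B(1) unfolding on_def orthonormal_basis_def by blast
qed

text \<open>The orthonormal basis in which \<^const>\<open>op_trace\<close> is computed.\<close>

definition onb :: "'a::fd_complex_hilbert set"
  where "onb = (SOME B. orthonormal_basis B)"

lemma onb: "orthonormal_basis (onb :: 'a::fd_complex_hilbert set)"
  unfolding onb_def using orthonormal_basis_exists by (rule someI_ex)

lemma finite_onb [simp]: "finite (onb :: 'a::fd_complex_hilbert set)"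
  using onb by (auto simp: orthonormal_basis_def)

lemma norm_onb: "e \<in> onb \<Longrightarrow> norm (e::'a::fd_complex_hilbert) = 1"
  using onb by (auto simp: orthonormal_basis_def cinner_self_1_iff[symmetric])

lemma onb_expansion: "(\<Sum>e\<in>onb. cinner e x *\<^sub>C e) = (x::'a::fd_complex_hilbert)"
  by (rule orthonormal_basis_expansion[OF onb, symmetric])

lemma parseval: "(\<Sum>e\<in>onb. cinner x e * cinner e y) = cinner x (y::'a::fd_complex_hilbert)"
proof -
  have "cinner x y = cinner x (\<Sum>e\<in>onb. cinner e y *\<^sub>C e)"
    by (simp add: onb_expansion)
  then show ?thesis
    by (simp add: cinner_sum_right cinner_scaleC_right mult.commute)
qed

lemma parseval_norm: "(\<Sum>e\<in>onb. (cmod (cinner e x))\<^sup>2) = (norm (x::'a::fd_complex_hilbert))\<^sup>2"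
proof -
  have "complex_of_real (\<Sum>e\<in>onb. (cmod (cinner e x))\<^sup>2) = (\<Sum>e\<in>onb. cinner x e * cinner e x)"
    by (simp add: complex_norm_square cinner_commute[of x] mult.commute del: of_real_power)
  also have "\<dots> = of_real ((norm x)\<^sup>2)"
    by (simp only: parseval cinner_self)
  finally show ?thesis
    using of_real_eq_iff by blast
qed

section \<open>The Frobenius norm\<close>

text \<open>For complex-linear operators this is the real part of Tr(adjoint(A) B), computed in the
  basis that \<open>op_trace\<close> uses. Being real-linear in A, it passes through Bochner
  integrals, which is how the lower bound exploits it.\<close>

definition hs_inner :: "('a::fd_complex_hilbert \<Rightarrow>\<^sub>L 'a) \<Rightarrow> ('a \<Rightarrow>\<^sub>L 'a) \<Rightarrow> real"
  where "hs_inner A B = (\<Sum>e\<in>onb. inner (blinfun_apply A e) (blinfun_apply B e))"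

definition hs_norm :: "('a::fd_complex_hilbert \<Rightarrow>\<^sub>L 'a) \<Rightarrow> real"
  where "hs_norm A = L2_set (\<lambda>e. norm (blinfun_apply A e)) onb"

lemma hs_norm_nonneg [simp]: "0 \<le> hs_norm A"
  by (simp add: hs_norm_def)

lemma hs_norm_sqrt: "hs_norm A = sqrt (\<Sum>e\<in>onb. (norm (blinfun_apply A e))\<^sup>2)"
  by (simp add: hs_norm_def L2_set_def)

lemma hs_norm_power2: "(hs_norm A)\<^sup>2 = (\<Sum>e\<in>onb. (norm (blinfun_apply A e))\<^sup>2)"
  by (simp add: hs_norm_sqrt sum_nonneg)

lemma hs_inner_self: "hs_inner A A = (hs_norm A)\<^sup>2"
  by (simp add: hs_norm_power2 hs_inner_def power2_norm_eq_inner)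

lemma hs_inner_le: "hs_inner A B \<le> hs_norm A * hs_norm B"
proof -
  have "hs_inner A B \<le> (\<Sum>e\<in>onb. norm (blinfun_apply A e) * norm (blinfun_apply B e))"
    unfolding hs_inner_def by (intro sum_mono norm_cauchy_schwarz)
  also have "\<dots> = (\<Sum>e\<in>onb. \<bar>norm (blinfun_apply A e)\<bar> * \<bar>norm (blinfun_apply B e)\<bar>)"
    by simp
  also have "\<dots> \<le> hs_norm A * hs_norm B"
    unfolding hs_norm_def by (rule L2_set_mult_ineq)
  finally show ?thesis .
qed

lemma hs_norm_triangle: "hs_norm (A + B) \<le> hs_norm A + hs_norm B"
proof -
  have "hs_norm (A + B) \<le> L2_set (\<lambda>e. norm (blinfun_apply A e) + norm (blinfun_apply B e)) onb"
    unfolding hs_norm_def by (intro L2_set_mono) (auto simp: blinfun.add_left norm_triangle_ineq)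
  also have "\<dots> \<le> hs_norm A + hs_norm B"
    unfolding hs_norm_def by (rule L2_set_triangle_ineq)
  finally show ?thesis .
qed

lemma bounded_linear_hs_inner: "bounded_linear (\<lambda>A. hs_inner A B)"
  unfolding hs_inner_def
  by (intro bounded_linear_sum bounded_linear_compose[OF bounded_linear_inner_left]
      blinfun.bounded_linear_left)

lemma continuous_on_hs_norm [continuous_intros]:
  "continuous_on S f \<Longrightarrow> continuous_on S (\<lambda>x. hs_norm (f x))"
  unfolding hs_norm_sqrt by (intro continuous_intros)

text \<open>Complex linearity enters through the expansion in \<open>onb\<close>, whose coefficients
  are complex. The estimate turns Frobenius lower bounds into statements about the norm
  topology.\<close>

lemma norm_le_hs_norm:
  assumes "clinear_op A"
  shows "norm A \<le> hs_norm A"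
proof (rule norm_blinfun_bound)
  fix x
  have "blinfun_apply A x = (\<Sum>e\<in>onb. cinner e x *\<^sub>C blinfun_apply A e)"
    using arg_cong[OF onb_expansion[of x, symmetric], of "blinfun_apply A"] assms
    by (simp add: blinfun.sum_right clinear_op_def)
  then have "norm (blinfun_apply A x) \<le> (\<Sum>e\<in>onb. \<bar>cmod (cinner e x)\<bar> * \<bar>norm (blinfun_apply A e)\<bar>)"
    using norm_sum[of "\<lambda>e. cinner e x *\<^sub>C blinfun_apply A e" onb] by (simp add: norm_scaleC)
  also have "\<dots> \<le> L2_set (\<lambda>e. cmod (cinner e x)) onb * hs_norm A"
    unfolding hs_norm_def by (rule L2_set_mult_ineq)
  also have "L2_set (\<lambda>e. cmod (cinner e x)) onb = norm x"
    by (simp add: L2_set_def parseval_norm)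
  finally show "norm (blinfun_apply A x) \<le> hs_norm A * norm x"
    by (simp add: mult.commute)
qed simp

text \<open>\<open>op_adjoint\<close> is a definite description, so the point is uniqueness: the
  values of two candidates differ by a vector orthogonal to everything.\<close>

lemma op_adjoint_self_adjoint:
  assumes "self_adjoint A"
  shows "op_adjoint A = A"
  unfolding op_adjoint_def
proof (rule the_equality)
  show "\<forall>x y. cinner (blinfun_apply A x) y = cinner x (blinfun_apply A y)"
    using assms unfolding self_adjoint_def .
  fix B assume B: "\<forall>x y. cinner (blinfun_apply A x) y = cinner x (blinfun_apply B y)"
  have "blinfun_apply B y - blinfun_apply A y = 0" for y
  proof (rule cinner_eq_zero_imp)
    fix x
    have "cinner x (blinfun_apply B y) = cinner x (blinfun_apply A y)"
      using B[rule_format, of x y] assms[unfolded self_adjoint_def, rule_format, of x y] by simp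
    then show "cinner x (blinfun_apply B y - blinfun_apply A y) = 0"
      by (simp add: cinner_diff_right)
  qed
  then show "B = A"
    by (intro blinfun_eqI) simp
qed

lemma frobenius_norm_self_adjoint:
  assumes "self_adjoint A"
  shows "frobenius_norm A = hs_norm A"
proof -
  have "Re (cinner e (blinfun_apply A (blinfun_apply A e))) = (norm (blinfun_apply A e))\<^sup>2" for e
  proof -
    have "cinner e (blinfun_apply A (blinfun_apply A e)) = cinner (blinfun_apply A e) (blinfun_apply A e)"
      by (rule assms[unfolded self_adjoint_def, rule_format, symmetric])
    then show ?thesis
      by (simp only: cinner_self Re_complex_of_real)
  qed
  then show ?thesis
    unfolding frobenius_norm_def op_adjoint_self_adjoint[OF assms] op_trace_def hs_norm_sqrt
      onb_def[symmetric]
    by simp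
qed

lemma self_adjoint_diff: "self_adjoint A \<Longrightarrow> self_adjoint B \<Longrightarrow> self_adjoint (A - B)"
  by (simp add: self_adjoint_def blinfun.diff_left cinner_diff_left cinner_diff_right)

lemma clinear_op_diff: "clinear_op A \<Longrightarrow> clinear_op B \<Longrightarrow> clinear_op (A - B)"
  by (simp add: clinear_op_def blinfun.diff_left scaleC_diff_right)

section \<open>Pure states and density operators\<close>

lemma clinear_op_proj: "clinear_op (proj \<psi>)"
  by (simp add: clinear_op_def blinfun_apply_proj cinner_scaleC_right scaleC_scaleC)

lemma self_adjoint_proj: "self_adjoint (proj \<psi>)"
  unfolding self_adjoint_def
proof (intro allI)
  fix x y
  show "cinner (blinfun_apply (proj \<psi>) x) y = cinner x (blinfun_apply (proj \<psi>) y)"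
    using cinner_commute[of x \<psi>]
    by (simp add: blinfun_apply_proj cinner_scaleC_right cinner_scaleC_left)
qed

lemma cinner_proj: "cinner x (blinfun_apply (proj \<psi>) x) = of_real ((cmod (cinner \<psi> x))\<^sup>2)"
  using cinner_commute[of x \<psi>]
  by (simp add: blinfun_apply_proj cinner_scaleC_right complex_norm_square del: of_real_power)

lemma op_trace_proj: "op_trace (proj \<psi>) = of_real ((norm \<psi>)\<^sup>2)"
proof -
  have "op_trace (proj \<psi>) = of_real (\<Sum>e\<in>onb. (cmod (cinner e \<psi>))\<^sup>2)"
    unfolding op_trace_def onb_def[symmetric] cinner_proj of_real_sum
    by (metis (no_types, opaque_lifting) cinner_commute complex_mod_cnj)
  then show ?thesis
    by (simp only: parseval_norm)
qed

lemma pure_states_eq: "pure_states = proj ` sphere 0 1"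
  by (auto simp: pure_states_def cinner_self_1_iff)

lemma pure_states_nonempty: "pure_states \<noteq> ({} :: ('a::fd_complex_hilbert \<Rightarrow>\<^sub>L 'a) set)"
  by (simp add: pure_states_eq)

lemma pure_states_subset_density_ops: "pure_states \<subseteq> density_ops"
  by (auto simp: pure_states_eq density_ops_def clinear_op_proj self_adjoint_proj op_trace_proj
      cinner_proj simp del: of_real_power)

lemma proj_diff_apply:
  "blinfun_apply (proj \<psi> - proj \<phi>) x = cinner (\<psi> - \<phi>) x *\<^sub>C \<psi> + cinner \<phi> x *\<^sub>C (\<psi> - \<phi>)"
  by (simp add: blinfun.diff_left blinfun_apply_proj cinner_diff_left scaleC_diff_left scaleC_diff_right)

lemma norm_proj_diff_le: "norm (proj \<psi> - proj \<phi>) \<le> (norm \<psi> + norm \<phi>) * norm (\<psi> - \<phi>)"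
proof (rule norm_blinfun_bound)
  fix x
  have "norm (blinfun_apply (proj \<psi> - proj \<phi>) x)
      \<le> cmod (cinner (\<psi> - \<phi>) x) * norm \<psi> + cmod (cinner \<phi> x) * norm (\<psi> - \<phi>)"
    unfolding proj_diff_apply by (rule order_trans[OF norm_triangle_ineq]) (simp add: norm_scaleC)
  also have "\<dots> \<le> (norm (\<psi> - \<phi>) * norm x) * norm \<psi> + (norm \<phi> * norm x) * norm (\<psi> - \<phi>)"
    by (intro add_mono mult_right_mono cmod_cinner_le) auto
  finally show "norm (blinfun_apply (proj \<psi> - proj \<phi>) x) \<le> (norm \<psi> + norm \<phi>) * norm (\<psi> - \<phi>) * norm x"
    by (simp add: algebra_simps)
qed simp

text \<open>\<open>proj\<close> is 2-Lipschitz on the unit sphere, which is compact in finite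
  dimension.\<close>

lemma compact_pure_states: "compact (pure_states :: ('a::fd_complex_hilbert \<Rightarrow>\<^sub>L 'a) set)"
proof -
  have "lipschitz_on 2 (sphere 0 1) (proj :: 'a \<Rightarrow> _)"
  proof (rule lipschitz_onI)
    fix x y :: 'a assume "x \<in> sphere 0 1" "y \<in> sphere 0 1"
    then show "dist (proj x) (proj y) \<le> 2 * dist x y"
      using norm_proj_diff_le[of x y] by (simp add: dist_norm)
  qed simp
  then show ?thesis
    unfolding pure_states_eq by (intro compact_continuous_image lipschitz_on_continuous_on) auto
qed

section \<open>The trace, the cone of positive operators, and the set of density operators\<close>

lemma op_trace_add: "op_trace (A + B) = op_trace A + op_trace B"
  by (simp add: op_trace_def blinfun.add_left cinner_add_right sum.distrib)

lemma op_trace_scaleR: "op_trace (r *\<^sub>R A) = of_real r * op_trace A"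
  by (simp add: op_trace_def blinfun.scaleR_left cinner_scaleR_right sum_distrib_left)

lemma op_trace_diff: "op_trace (A - B) = op_trace A - op_trace B"
  using op_trace_add[of "A - B" B] by simp

text \<open>The cone over the density operators; without the trace normalization, rank-one pieces
  can be subtracted one at a time.\<close>

definition pos_op :: "('a::fd_complex_hilbert \<Rightarrow>\<^sub>L 'a) \<Rightarrow> bool"
  where "pos_op A \<longleftrightarrow> clinear_op A \<and> self_adjoint A \<and> (\<forall>x. 0 \<le> Re (cinner x (blinfun_apply A x)))"

lemma density_ops_iff: "A \<in> density_ops \<longleftrightarrow> pos_op A \<and> op_trace A = 1"
  by (auto simp: density_ops_def pos_op_def)

lemma pos_op_add: "pos_op A \<Longrightarrow> pos_op B \<Longrightarrow> pos_op (A + B)"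
  by (simp add: pos_op_def clinear_op_def self_adjoint_def blinfun.add_left scaleC_add_right
      cinner_add_left cinner_add_right)

lemma pos_op_scaleR: "0 \<le> r \<Longrightarrow> pos_op A \<Longrightarrow> pos_op (r *\<^sub>R A)"
  by (simp add: pos_op_def clinear_op_def self_adjoint_def blinfun.scaleR_left scaleC_scaleR
      cinner_scaleR_left cinner_scaleR_right)

lemma pos_op_id: "pos_op id_blinfun"
  by (simp add: pos_op_def clinear_op_def self_adjoint_def cinner_self del: of_real_power)

lemma op_trace_id: "op_trace (id_blinfun :: 'a::fd_complex_hilbert \<Rightarrow>\<^sub>L 'a) = of_nat (card (onb :: 'a set))"
proof -
  have "cinner e e = 1" if "e \<in> onb" for e :: 'a
    using that by (simp add: cinner_self_1_iff norm_onb)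
  then show ?thesis
    by (simp add: op_trace_def flip: onb_def)
qed

lemma card_onb_pos: "0 < card (onb :: 'a::fd_complex_hilbert set)"
proof -
  have "onb \<noteq> ({} :: 'a set)"
  proof
    assume "onb = ({} :: 'a set)"
    then have "x = 0" for x :: 'a
      using onb_expansion[of x] by simp
    then show False
      using nonzero_Basis[OF SOME_Basis] by metis
  qed
  then show ?thesis
    by (simp add: card_gt_0_iff)
qed

lemma convex_density_ops: "convex density_ops"
  by (rule convexI)
    (auto simp: density_ops_iff pos_op_add pos_op_scaleR op_trace_add op_trace_scaleR
      simp flip: of_real_add)

lemma bounded_bilinear_cinner:
  "bounded_bilinear (cinner :: 'a::fd_complex_hilbert \<Rightarrow> 'a \<Rightarrow> complex)"
proof
  show "\<exists>K. \<forall>a b. norm (cinner a (b::'a)) \<le> norm a * norm b * K"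
    using cmod_cinner_le by (intro exI[of _ 1]) auto
qed (auto simp: cinner_add_left cinner_add_right cinner_scaleR_left cinner_scaleR_right scaleR_conv_of_real)

lemmas continuous_on_cinner [continuous_intros] =
  bounded_bilinear.continuous_on[OF bounded_bilinear_cinner]

lemma bounded_linear_scaleC: "bounded_linear (\<lambda>x::'a::fd_complex_hilbert. a *\<^sub>C x)"
  by (rule bounded_linear_intro[where K = "cmod a"])
    (auto simp: scaleC_add_right scaleC_scaleR norm_scaleC)

lemma closed_density_ops: "closed (density_ops :: ('a::fd_complex_hilbert \<Rightarrow>\<^sub>L 'a) set)"
proof -
  have "density_ops = {\<rho>::'a \<Rightarrow>\<^sub>L 'a. \<forall>a x. blinfun_apply \<rho> (a *\<^sub>C x) = a *\<^sub>C blinfun_apply \<rho> x}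
      \<inter> {\<rho>. \<forall>x y. cinner (blinfun_apply \<rho> x) y = cinner x (blinfun_apply \<rho> y)}
      \<inter> {\<rho>. \<forall>x. 0 \<le> Re (cinner x (blinfun_apply \<rho> x))}
      \<inter> {\<rho>. op_trace \<rho> = 1}"
    by (auto simp: density_ops_def clinear_op_def self_adjoint_def)
  also have "closed \<dots>"
    unfolding op_trace_def
    by (intro closed_Int closed_Collect_all closed_Collect_eq closed_Collect_le continuous_intros
        bounded_linear.continuous_on[OF bounded_linear_scaleC])
  finally show ?thesis .
qed

text \<open>Positivity is tested on y - l x with l = r * g, where r is real and g = <x|A y>. This
  phase makes both cross terms real, so that a real quadratic in r remains.\<close>

lemma pos_op_cauchy_schwarz:
  assumes "pos_op A"
  shows "(cmod (cinner x (blinfun_apply A y)))\<^sup>2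
    \<le> Re (cinner x (blinfun_apply A x)) * Re (cinner y (blinfun_apply A y))"
proof -
  define g where "g = cinner x (blinfun_apply A y)"
  define a where "a = Re (cinner x (blinfun_apply A x))"
  define b where "b = Re (cinner y (blinfun_apply A y))"
  define G where "G = (cmod g)\<^sup>2"
  have sa: "cinner (blinfun_apply A u) v = cinner u (blinfun_apply A v)" for u v
    using assms by (simp add: pos_op_def self_adjoint_def)
  have lin: "blinfun_apply A (c *\<^sub>C u) = c *\<^sub>C blinfun_apply A u" for c u
    using assms by (simp add: pos_op_def clinear_op_def)
  have pos: "0 \<le> Re (cinner u (blinfun_apply A u))" for u
    using assms by (simp add: pos_op_def)
  have yx: "cinner y (blinfun_apply A x) = cnj g"
    using cinner_commute[of y "blinfun_apply A x"] by (simp add: g_def sa)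
  have key: "0 \<le> b - 2 * r * G + r\<^sup>2 * G * a" for r :: real
  proof -
    define l where "l = of_real r * g"
    have "cinner (y - l *\<^sub>C x) (blinfun_apply A (y - l *\<^sub>C x))
        = cinner y (blinfun_apply A y) - l * cnj g - cnj l * g + (cnj l * l) * cinner x (blinfun_apply A x)"
      by (simp add: blinfun.diff_right lin cinner_diff_left cinner_diff_right cinner_scaleC_left
          cinner_scaleC_right yx algebra_simps flip: g_def)
    also have "cnj l * l = of_real (r\<^sup>2 * G)"
      by (simp add: l_def G_def complex_norm_square power2_eq_square[of r] mult_ac del: of_real_power)
    also have "l * cnj g = of_real (r * G)"
      by (simp add: l_def G_def complex_norm_square del: of_real_power)
    also have "cnj l * g = of_real (r * G)"
      by (simp add: l_def G_def complex_norm_square mult_ac del: of_real_power)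
    finally show ?thesis
      using pos[of "y - l *\<^sub>C x"] by (simp add: a_def b_def del: of_real_mult of_real_power)
  qed
  have "0 \<le> a" "0 \<le> b" "0 \<le> G"
    using pos by (auto simp: a_def b_def G_def)
  have "G \<le> a * b"
  proof (cases "a = 0")
    case True
    have "G = 0"
    proof (rule ccontr)
      assume "G \<noteq> 0"
      \<comment> \<open>For a = 0 the expression is affine in r, and this r gives it the value
        -1.\<close>
      then show False
        using key[of "(b + 1) / (2 * G)"] True \<open>0 \<le> b\<close> by (simp add: field_simps)
    qed
    then show ?thesis
      using True by simp
  next
    case False
    \<comment> \<open>r = 1 / a minimizes the quadratic.\<close>
    then have "0 \<le> b - G / a"
      using key[of "1 / a"] by (simp add: power2_eq_square)
    then show ?thesis
      using False \<open>0 \<le> a\<close> by (simp add: field_simps)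
  qed
  then show ?thesis
    by (simp add: G_def g_def a_def b_def)
qed

lemma proj_scaleC: "proj (a *\<^sub>C \<psi>) = (cmod a)\<^sup>2 *\<^sub>R proj \<psi>"
  by (rule blinfun_eqI)
    (simp add: blinfun_apply_proj blinfun.scaleR_left cinner_scaleC_left scaleC_scaleC
      complex_norm_square mult_ac flip: scaleC_of_real del: of_real_power)

lemma proj_eq_scaleR_pure:
  assumes "\<psi> \<noteq> 0"
  obtains P where "P \<in> pure_states" "proj \<psi> = (norm \<psi>)\<^sup>2 *\<^sub>R P"
proof
  let ?\<phi> = "of_real (inverse (norm \<psi>)) *\<^sub>C \<psi>"
  show "proj ?\<phi> \<in> pure_states"
    using assms by (simp add: pure_states_eq norm_scaleC norm_inverse)
  have "(norm \<psi>)\<^sup>2 * (inverse (norm \<psi>))\<^sup>2 = 1"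
    using assms by (simp add: power_inverse)
  then show "proj \<psi> = (norm \<psi>)\<^sup>2 *\<^sub>R proj ?\<phi>"
    by (simp add: proj_scaleC norm_inverse)
qed

text \<open>
  Peeling off \<open>proj (A x) / \<langle>x|A x\<rangle>\<close> keeps \<open>A\<close> positive, by Cauchy-Schwarz, and enlarges its
  kernel by \<open>x\<close>; so no spectral theorem is needed.
\<close>

lemma pos_op_eq_scaleR_hull:
  fixes A :: "'a::fd_complex_hilbert \<Rightarrow>\<^sub>L 'a"
  assumes "pos_op A"
  shows "\<exists>t\<ge>0. \<exists>\<rho>\<in>convex hull pure_states. A = t *\<^sub>R \<rho>"
  using assms
proof (induction "DIM('a) - dim {x. blinfun_apply A x = 0}" arbitrary: A rule: less_induct)
  case less
  show ?case
  proof (cases "A = 0")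
    case True
    then show ?thesis
      using pure_states_nonempty[where 'a = 'a] by (intro exI[of _ 0]) (auto intro: hull_inc)
  next
    case False
    then obtain x where x: "blinfun_apply A x \<noteq> 0"
      by (metis blinfun_eqI zero_blinfun.rep_eq)
    have sa: "cinner (blinfun_apply A u) v = cinner u (blinfun_apply A v)" for u v
      using less.prems by (simp add: pos_op_def self_adjoint_def)
    define a where "a = Re (cinner x (blinfun_apply A x))"
    have ca: "cinner (blinfun_apply A x) x = of_real a"
      using sa[of x x] cinner_commute[of x "blinfun_apply A x"] by (auto simp: a_def complex_eq_iff)
    have "0 \<le> a"
      using less.prems by (simp add: a_def pos_op_def)
    \<comment> \<open>If a were 0, Cauchy-Schwarz for x and A x would make <x|A (A x)>, the squared
      norm of A x, vanish.\<close>
    have "a \<noteq> 0"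
    proof
      assume "a = 0"
      then have "cinner (blinfun_apply A x) (blinfun_apply A x) = 0"
        using pos_op_cauchy_schwarz[OF less.prems, of x "blinfun_apply A x"]
        by (simp add: a_def sa)
      then show False
        using x by (simp add: cinner_self)
    qed
    then have "0 < a"
      using \<open>0 \<le> a\<close> by simp
    define B where "B = A - (1 / a) *\<^sub>R proj (blinfun_apply A x)"
    have B_apply: "blinfun_apply B y = blinfun_apply A y
        - (1 / a) *\<^sub>R (cinner (blinfun_apply A x) y *\<^sub>C blinfun_apply A x)" for y
      by (simp add: B_def blinfun.diff_left blinfun.scaleR_left blinfun_apply_proj)
    have "pos_op B"
      unfolding pos_op_def
    proof (intro conjI allI)
      show "clinear_op B"
        using less.prems clinear_op_proj[of "blinfun_apply A x"] unfolding B_def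
        by (simp add: pos_op_def clinear_op_def blinfun.diff_left blinfun.scaleR_left
            scaleC_diff_right scaleC_scaleR)
      show "self_adjoint B"
        using less.prems self_adjoint_proj[of "blinfun_apply A x"] unfolding B_def
        by (simp add: pos_op_def self_adjoint_def blinfun.diff_left blinfun.scaleR_left
            cinner_diff_left cinner_diff_right cinner_scaleR_left cinner_scaleR_right)
      fix y
      have "(cmod (cinner (blinfun_apply A x) y))\<^sup>2 \<le> a * Re (cinner y (blinfun_apply A y))"
        using pos_op_cauchy_schwarz[OF less.prems, of x y] by (simp add: a_def sa)
      then have "(1 / a) * (cmod (cinner (blinfun_apply A x) y))\<^sup>2 \<le> Re (cinner y (blinfun_apply A y))"
        using \<open>0 < a\<close> by (simp add: field_simps)
      moreover have "cinner y (blinfun_apply B y) = cinner y (blinfun_apply A y)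
          - of_real ((1 / a) * (cmod (cinner (blinfun_apply A x) y))\<^sup>2)"
        by (simp add: B_def blinfun.diff_left blinfun.scaleR_left cinner_diff_right
            cinner_scaleR_right cinner_proj)
      ultimately show "0 \<le> Re (cinner y (blinfun_apply B y))"
        by (simp only: minus_complex.simps Re_complex_of_real)
    qed
    moreover have "DIM('a) - dim {y. blinfun_apply B y = 0} < DIM('a) - dim {y. blinfun_apply A y = 0}"
    proof -
      have sub: "subspace {y. blinfun_apply C y = 0}" for C :: "'a \<Rightarrow>\<^sub>L 'a"
        by (auto simp: subspace_def blinfun.add_right blinfun.scaleR_right)
      \<comment> \<open>The factor 1 / a makes the subtracted term at x equal to A x; an old kernel
        vector y survives because <A x|y> = <x|A y> = 0.\<close>
      have "blinfun_apply B x = 0"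
        using \<open>a \<noteq> 0\<close> by (simp add: B_apply ca scaleC_of_real)
      moreover have "blinfun_apply B y = 0" if "blinfun_apply A y = 0" for y
        using that by (simp add: B_apply sa)
      ultimately have "{y. blinfun_apply A y = 0} \<subset> {y. blinfun_apply B y = 0}"
        using x by auto
      then have "dim {y. blinfun_apply A y = 0} < dim {y. blinfun_apply B y = 0}"
        using sub by (intro dim_psubset) (metis span_eq_iff)
      then show ?thesis
        using dim_subset_UNIV[of "{y. blinfun_apply B y = 0}"] by linarith
    qed
    ultimately obtain t \<rho> where t: "0 \<le> t" "\<rho> \<in> convex hull pure_states" "B = t *\<^sub>R \<rho>"
      using less.hyps[of B] by blast
    obtain P where P: "P \<in> pure_states" "proj (blinfun_apply A x) = (norm (blinfun_apply A x))\<^sup>2 *\<^sub>R P"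
      using proj_eq_scaleR_pure[OF x] .
    define s where "s = (norm (blinfun_apply A x))\<^sup>2 / a"
    have "0 < s"
      using x \<open>0 < a\<close> by (simp add: s_def)
    have "A = t *\<^sub>R \<rho> + s *\<^sub>R P"
      using t(3) P(2) by (simp add: B_def s_def algebra_simps)
    also have "\<dots> = (t + s) *\<^sub>R ((t / (t + s)) *\<^sub>R \<rho> + (s / (t + s)) *\<^sub>R P)"
      using t(1) \<open>0 < s\<close> by (simp add: scaleR_add_right)
    finally have "A = (t + s) *\<^sub>R ((t / (t + s)) *\<^sub>R \<rho> + (s / (t + s)) *\<^sub>R P)" .
    moreover have "(t / (t + s)) *\<^sub>R \<rho> + (s / (t + s)) *\<^sub>R P \<in> convex hull pure_states"
      using t(1,2) P(1) \<open>0 < s\<close>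
      by (intro convexD[OF convex_convex_hull]) (auto intro: hull_inc simp flip: add_divide_distrib)
    ultimately show ?thesis
      using t(1) \<open>0 < s\<close> by (intro exI[of _ "t + s"]) auto
  qed
qed

text \<open>The trace is 1 on the hull as well as on a density operator, which forces the factor t
  of \<open>pos_op_eq_scaleR_hull\<close> to be 1.\<close>

lemma density_ops_eq_hull: "density_ops = convex hull pure_states"
proof
  show *: "convex hull pure_states \<subseteq> (density_ops :: ('a \<Rightarrow>\<^sub>L 'a) set)"
    by (intro hull_minimal pure_states_subset_density_ops convex_density_ops)
  show "(density_ops :: ('a \<Rightarrow>\<^sub>L 'a) set) \<subseteq> convex hull pure_states"
  proof
    fix A :: "'a \<Rightarrow>\<^sub>L 'a" assume A: "A \<in> density_ops"
    then obtain t \<rho> where t: "\<rho> \<in> convex hull pure_states" "A = t *\<^sub>R \<rho>"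
      using pos_op_eq_scaleR_hull[of A] by (auto simp: density_ops_iff)
    moreover have "t = 1"
      using A t * by (auto simp: density_ops_iff op_trace_scaleR)
    ultimately show "A \<in> convex hull pure_states"
      by simp
  qed
qed

lemma compact_density_ops: "compact (density_ops :: ('a::fd_complex_hilbert \<Rightarrow>\<^sub>L 'a) set)"
proof -
  have "bounded (density_ops :: ('a \<Rightarrow>\<^sub>L 'a) set)"
    unfolding density_ops_eq_hull
    by (intro bounded_convex_hull compact_imp_bounded compact_pure_states)
  then show ?thesis
    using closed_density_ops by (simp add: compact_eq_bounded_closed)
qed

lemma frobenius_norm_density_diff:
  "\<rho> \<in> density_ops \<Longrightarrow> \<sigma> \<in> density_ops \<Longrightarrow> frobenius_norm (\<rho> - \<sigma>) = hs_norm (\<rho> - \<sigma>)"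
  by (intro frobenius_norm_self_adjoint self_adjoint_diff) (auto simp: density_ops_def)

lemma norm_density_diff_le:
  "\<rho> \<in> density_ops \<Longrightarrow> \<sigma> \<in> density_ops \<Longrightarrow> norm (\<rho> - \<sigma>) \<le> hs_norm (\<rho> - \<sigma>)"
  by (intro norm_le_hs_norm clinear_op_diff) (auto simp: density_ops_def)

text \<open>
  The mixture is a normalization of \<open>\<rho> + (t - (\<rho> - \<sigma>)) = \<sigma> + t\<close> for \<open>t = \<parallel>\<rho> - \<sigma>\<parallel>\<close>.
\<close>

lemma density_ops_common_mixture:
  fixes \<rho> \<sigma> :: "'a::fd_complex_hilbert \<Rightarrow>\<^sub>L 'a"
  assumes "\<rho> \<in> density_ops" "\<sigma> \<in> density_ops"
  obtains \<epsilon> \<eta> \<theta> where "0 \<le> \<epsilon>" "\<epsilon> \<le> 1" "\<epsilon> \<le> card (onb :: 'a set) * norm (\<rho> - \<sigma>)"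
    "\<eta> \<in> density_ops" "\<theta> \<in> density_ops"
    "(1 - \<epsilon>) *\<^sub>R \<rho> + \<epsilon> *\<^sub>R \<eta> = (1 - \<epsilon>) *\<^sub>R \<sigma> + \<epsilon> *\<^sub>R \<theta>"
proof (cases "\<rho> = \<sigma>")
  case True
  then show thesis
    using that[of 0 \<rho> \<rho>] assms by auto
next
  case False
  define n where "n = real (card (onb :: 'a set))"
  define t where "t = norm (\<rho> - \<sigma>)"
  have n: "0 < n"
    using card_onb_pos[where 'a = 'a] by (simp add: n_def)
  have t: "0 < t"
    using False by (simp add: t_def)
  \<comment> \<open>Positive because t is the operator norm of \<rho> - \<sigma>, and of trace n * t
    because \<rho> and \<sigma> have equal trace. Hence \<rho> + \<delta> has trace 1 + n * t, and
    \<open>\<epsilon>\<close> below is the share of \<delta> in it.\<close>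
  define \<delta> where "\<delta> = t *\<^sub>R id_blinfun - (\<rho> - \<sigma>)"
  define \<eta> where "\<eta> = (1 / (n * t)) *\<^sub>R \<delta>"
  define \<theta> :: "'a \<Rightarrow>\<^sub>L 'a" where "\<theta> = (1 / n) *\<^sub>R id_blinfun"
  define \<epsilon> where "\<epsilon> = n * t / (1 + n * t)"
  have ratio: "m / (1 + m) \<le> 1" "m / (1 + m) \<le> m" if "0 < m" for m :: real
    using that by (simp_all add: field_simps)
  have nt: "0 < n * t"
    using n t by simp
  have "0 \<le> \<epsilon>" "\<epsilon> \<le> 1" "\<epsilon> \<le> n * t"
    using ratio[OF nt] nt by (auto simp: \<epsilon>_def)
  moreover have "\<theta> \<in> density_ops"
    using card_onb_pos[where 'a = 'a]
    by (simp add: \<theta>_def density_ops_iff pos_op_scaleR pos_op_id op_trace_scaleR op_trace_id n_def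
        card_gt_0_iff)
  moreover have "pos_op \<delta>"
    unfolding pos_op_def
  proof (intro conjI allI)
    show "clinear_op \<delta>"
      using assms pos_op_scaleR[OF less_imp_le[OF t] pos_op_id[where 'a = 'a]] unfolding \<delta>_def
      by (intro clinear_op_diff) (auto simp: density_ops_def pos_op_def)
    show "self_adjoint \<delta>"
      using assms pos_op_scaleR[OF less_imp_le[OF t] pos_op_id[where 'a = 'a]] unfolding \<delta>_def
      by (intro self_adjoint_diff) (auto simp: density_ops_def pos_op_def)
    fix x
    have "inner x (blinfun_apply (\<rho> - \<sigma>) x) \<le> norm x * (t * norm x)"
      unfolding t_def
      by (rule order_trans[OF norm_cauchy_schwarz]) (intro mult_left_mono norm_blinfun norm_ge_zero)
    then show "0 \<le> Re (cinner x (blinfun_apply \<delta> x))"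
      by (simp add: \<delta>_def blinfun.diff_left blinfun.scaleR_left power2_norm_eq_inner[symmetric]
          inner_diff_right power2_eq_square mult_ac flip: inner_eq_Re_cinner)
  qed
  then have "\<eta> \<in> density_ops"
    using assms n t
    by (simp add: \<eta>_def density_ops_iff pos_op_scaleR op_trace_scaleR \<delta>_def op_trace_diff op_trace_id n_def
        card_gt_0_iff)
  moreover have "(1 - \<epsilon>) *\<^sub>R \<rho> + \<epsilon> *\<^sub>R \<eta> = (1 - \<epsilon>) *\<^sub>R \<sigma> + \<epsilon> *\<^sub>R \<theta>"
  proof -
    have 1: "1 - \<epsilon> = 1 / (1 + n * t)"
      using nt by (simp add: \<epsilon>_def field_simps)
    have 2: "\<epsilon> *\<^sub>R \<eta> = (1 / (1 + n * t)) *\<^sub>R \<delta>"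
      using nt n t by (simp add: \<epsilon>_def \<eta>_def)
    have 3: "\<epsilon> *\<^sub>R \<theta> = (1 / (1 + n * t)) *\<^sub>R (t *\<^sub>R id_blinfun)"
      using nt n by (simp add: \<epsilon>_def \<theta>_def)
    show ?thesis
      unfolding 1 2 3 scaleR_add_right[symmetric] by (simp add: \<delta>_def)
  qed
  ultimately show thesis
    using that by (simp add: n_def t_def)
qed

section \<open>The distances on pure states\<close>

lemma state_vec:
  assumes "P \<in> pure_states"
  shows "norm (state_vec P) = 1" "proj (state_vec P) = P"
proof -
  have "\<exists>\<psi>. cinner \<psi> \<psi> = 1 \<and> proj \<psi> = P"
    using assms by (auto simp: pure_states_def)
  then have "cinner (state_vec P) (state_vec P) = 1 \<and> proj (state_vec P) = P"
    unfolding state_vec_def by (rule someI_ex)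
  then show "norm (state_vec P) = 1" "proj (state_vec P) = P"
    by (auto simp: cinner_self_1_iff)
qed

text \<open>The squared modulus of <\<psi>|\<xi>> equals <\<xi>|proj \<psi> \<xi>>, a function of
  the projector; so the arbitrary choice made by \<open>state_vec\<close> does not affect the
  distances.\<close>

lemma cmod_cinner_cong_proj:
  assumes "proj \<psi> = proj \<psi>'" "proj \<phi> = proj \<phi>'"
  shows "cmod (cinner \<psi> \<phi>) = cmod (cinner \<psi>' \<phi>')"
proof -
  have eq: "cmod (cinner \<alpha> \<xi>) = cmod (cinner \<beta> \<xi>)" if "proj \<alpha> = proj \<beta>" for \<alpha> \<beta> \<xi> :: 'a
  proof -
    have "complex_of_real ((cmod (cinner \<alpha> \<xi>))\<^sup>2) = of_real ((cmod (cinner \<beta> \<xi>))\<^sup>2)"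
      by (simp only: that flip: cinner_proj)
    then have "(cmod (cinner \<alpha> \<xi>))\<^sup>2 = (cmod (cinner \<beta> \<xi>))\<^sup>2"
      by (simp only: of_real_eq_iff)
    then show ?thesis
      by (rule power2_eq_imp_eq) auto
  qed
  have comm: "cmod (cinner \<alpha> \<beta>) = cmod (cinner \<beta> \<alpha>)" for \<alpha> \<beta> :: 'a
    by (subst cinner_commute) simp
  show ?thesis
    using eq[OF assms(1), of \<phi>] eq[OF assms(2), of \<psi>'] comm[of \<psi>' \<phi>] comm[of \<psi>' \<phi>'] by simp
qed

lemma cmod_cinner_state_vec:
  assumes "norm \<psi> = 1" "norm \<phi> = 1"
  shows "cmod (cinner (state_vec (proj \<psi>)) (state_vec (proj \<phi>))) = cmod (cinner \<psi> \<phi>)"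
  using assms by (intro cmod_cinner_cong_proj state_vec) (auto simp: pure_states_eq)

text \<open>For the two projectors P and Q the squared norm is Tr P + Tr Q - 2 Tr(PQ), and Tr(PQ) is
  the squared modulus of <\<psi>|\<phi>>.\<close>

lemma hs_norm_proj_diff:
  assumes "norm \<psi> = 1" "norm \<phi> = 1"
  shows "hs_norm (proj \<psi> - proj \<phi>) = sqrt 2 * sqrt (1 - (cmod (cinner \<psi> \<phi>))\<^sup>2)"
proof -
  have norm_proj: "(\<Sum>e\<in>onb. (norm (blinfun_apply (proj \<xi>) e))\<^sup>2) = 1" if "norm \<xi> = 1" for \<xi> :: 'a
  proof -
    have "(\<Sum>e\<in>onb. (norm (blinfun_apply (proj \<xi>) e))\<^sup>2) = (\<Sum>e\<in>onb. (cmod (cinner e \<xi>))\<^sup>2)"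
      using that by (intro sum.cong refl)
        (metis blinfun_apply_proj cinner_commute complex_mod_cnj mult.right_neutral norm_scaleC)
    then show ?thesis
      using that by (simp add: parseval_norm)
  qed
  have inner_proj: "inner (blinfun_apply (proj \<psi>) e) (blinfun_apply (proj \<phi>) e)
      = Re (cinner \<phi> e * cinner e \<psi> * cinner \<psi> \<phi>)" for e
    unfolding inner_eq_Re_cinner blinfun_apply_proj cinner_scaleC_left cinner_scaleC_right
      cinner_commute[of e \<psi>] by (simp add: mult_ac)
  have "(\<Sum>e\<in>onb. inner (blinfun_apply (proj \<psi>) e) (blinfun_apply (proj \<phi>) e))
      = Re ((\<Sum>e\<in>onb. cinner \<phi> e * cinner e \<psi>) * cinner \<psi> \<phi>)"
    by (simp only: inner_proj sum_distrib_right Re_sum)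
  also have "\<dots> = (cmod (cinner \<psi> \<phi>))\<^sup>2"
    unfolding parseval cinner_commute[of \<phi> \<psi>]
    by (simp add: cmod_power2 flip: power2_eq_square)
  finally have cross: "(\<Sum>e\<in>onb. inner (blinfun_apply (proj \<psi>) e) (blinfun_apply (proj \<phi>) e))
      = (cmod (cinner \<psi> \<phi>))\<^sup>2" .
  have "(norm (blinfun_apply (proj \<psi> - proj \<phi>) e))\<^sup>2 = (norm (blinfun_apply (proj \<psi>) e))\<^sup>2
      + (norm (blinfun_apply (proj \<phi>) e))\<^sup>2
      - 2 * inner (blinfun_apply (proj \<psi>) e) (blinfun_apply (proj \<phi>) e)" for e
    by (simp add: blinfun.diff_left power2_norm_eq_inner inner_diff_left inner_diff_right inner_commute)
  then have "(\<Sum>e\<in>onb. (norm (blinfun_apply (proj \<psi> - proj \<phi>) e))\<^sup>2)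
      = 2 * (1 - (cmod (cinner \<psi> \<phi>))\<^sup>2)"
    using norm_proj[OF assms(1)] norm_proj[OF assms(2)] cross
    by (simp add: sum.distrib sum_subtractf flip: sum_distrib_left)
  then show ?thesis
    by (simp add: hs_norm_sqrt flip: real_sqrt_mult)
qed

lemma d_Fr_proj:
  assumes "norm \<psi> = 1" "norm \<phi> = 1"
  shows "d_Fr (proj \<psi>) (proj \<phi>) = sqrt 2 * sqrt (1 - (cmod (cinner \<psi> \<phi>))\<^sup>2)"
  by (simp add: d_Fr_def cmod_cinner_state_vec[OF assms])

lemma d_FS_proj:
  assumes "norm \<psi> = 1" "norm \<phi> = 1"
  shows "d_FS (proj \<psi>) (proj \<phi>) = arccos (cmod (cinner \<psi> \<phi>))"
  by (simp add: d_FS_def cmod_cinner_state_vec[OF assms])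

lemma d_Fr_eq_hs_norm:
  assumes "P \<in> pure_states" "Q \<in> pure_states"
  shows "d_Fr P Q = hs_norm (P - Q)"
  using hs_norm_proj_diff[OF state_vec(1)[OF assms(1)] state_vec(1)[OF assms(2)]] assms
  by (simp add: d_Fr_def state_vec)

text \<open>\<open>state_vec\<close> is a choice function without continuity, whereas this formula
  in P - Q shows that the distance is continuous. The second claim keeps the argument of
  \<open>arccos\<close> in its domain.\<close>

lemma d_FS_eq_hs_norm:
  assumes "P \<in> pure_states" "Q \<in> pure_states"
  shows "d_FS P Q = arccos (sqrt (1 - (hs_norm (P - Q))\<^sup>2 / 2))"
    and "0 \<le> 1 - (hs_norm (P - Q))\<^sup>2 / 2"
proof -
  let ?r = "cmod (cinner (state_vec P) (state_vec Q))"
  have "?r \<le> 1"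
    using cmod_cinner_le[of "state_vec P" "state_vec Q"] assms by (simp add: state_vec)
  then have "?r\<^sup>2 \<le> 1"
    by (simp add: power_le_one)
  then have "(hs_norm (P - Q))\<^sup>2 = 2 * (1 - ?r\<^sup>2)"
    using hs_norm_proj_diff[OF state_vec(1)[OF assms(1)] state_vec(1)[OF assms(2)]] assms
    by (simp add: state_vec power_mult_distrib)
  then show "d_FS P Q = arccos (sqrt (1 - (hs_norm (P - Q))\<^sup>2 / 2))"
    "0 \<le> 1 - (hs_norm (P - Q))\<^sup>2 / 2"
    by (simp_all add: d_FS_def diff_divide_distrib)
qed

text \<open>For the angle \<theta> = d_FS P Q one has hs_norm (P - Q) = sqrt 2 * sin \<theta>, so
  the bound is sin \<theta> \<le> \<theta>.\<close>

lemma d_FS_lower: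
  assumes "P \<in> pure_states" "Q \<in> pure_states"
  shows "2 powr (-1/2) * hs_norm (P - Q) \<le> d_FS P Q"
proof -
  let ?r = "cmod (cinner (state_vec P) (state_vec Q))"
  have r: "0 \<le> ?r" "?r \<le> 1"
    using cmod_cinner_le[of "state_vec P" "state_vec Q"] assms by (simp_all add: state_vec)
  have "2 powr (-1/2) * sqrt 2 = 1"
    by (simp add: powr_minus powr_half_sqrt field_simps)
  then have "2 powr (-1/2) * hs_norm (P - Q) = sqrt (1 - ?r\<^sup>2)"
    using hs_norm_proj_diff[OF state_vec(1)[OF assms(1)] state_vec(1)[OF assms(2)]] assms
    by (simp add: state_vec)
  also have "\<dots> = sin (arccos ?r)"
    using r by (intro sin_arccos_abs[symmetric]) linarith
  also have "\<dots> \<le> arccos ?r"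
    using r by (intro sin_x_le_x arccos_lbound) linarith+
  finally show ?thesis
    by (simp add: d_FS_def)
qed

text \<open>The curve is the great circle through a state vector of P and a phase-adjusted one of Q.
  Inner products along it are cos ((t - s) \<theta>), with \<theta> \<le> pi / 2 because the ends
  have nonnegative inner product. So for s, t in [0, 1] the modulus changes nothing and
  \<open>arccos\<close> recovers the angle.\<close>

lemma d_FS_geodesic:
  assumes "P \<in> pure_states" "Q \<in> pure_states"
  obtains \<gamma> where "\<gamma> 0 = P" "\<gamma> 1 = Q" "\<And>t. \<gamma> t \<in> pure_states"
    "\<And>s t. s \<in> {0..1} \<Longrightarrow> t \<in> {0..1} \<Longrightarrow> d_FS (\<gamma> s) (\<gamma> t) = \<bar>t - s\<bar> * d_FS P Q"
proof -
  obtain u where u: "cmod u = 1"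
    "cinner (state_vec P) (u *\<^sub>C state_vec Q) = of_real (cmod (cinner (state_vec P) (state_vec Q)))"
    by (rule cinner_phase)
  define \<psi> where "\<psi> = state_vec P"
  define \<phi> where "\<phi> = u *\<^sub>C state_vec Q"
  define r where "r = cmod (cinner \<psi> \<phi>)"
  have \<psi>: "norm \<psi> = 1" "proj \<psi> = P"
    using assms by (auto simp: \<psi>_def state_vec)
  have \<phi>: "norm \<phi> = 1" "proj \<phi> = Q"
    using assms u(1) by (auto simp: \<phi>_def state_vec norm_scaleC proj_scaleC)
  have \<psi>\<phi>: "cinner \<psi> \<phi> = of_real r"
    using u by (simp add: r_def \<psi>_def \<phi>_def)
  have r: "0 \<le> r" "r \<le> 1"
    using cmod_cinner_le[of \<psi> \<phi>] \<psi> \<phi> by (simp_all add: r_def)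
  define \<theta> where "\<theta> = arccos r"
  have d: "d_FS P Q = \<theta>"
    using d_FS_proj[OF \<psi>(1) \<phi>(1)] \<psi> \<phi> by (simp add: \<theta>_def r_def)
  have \<theta>: "cos \<theta> = r" "0 \<le> \<theta>" "\<theta> \<le> pi / 2"
    using r arccos_le_pi2[OF r] by (auto simp: \<theta>_def arccos_lbound)
  show thesis
  \<comment> \<open>For \<theta> = 0 there is no direction to rotate towards, but then the aligned
    vectors coincide.\<close>
  proof (cases "\<theta> = 0")
    case True
    have "norm (\<phi> - \<psi>) ^ 2 = 0"
      using True \<theta>(1) \<psi>(1) \<phi>(1) \<psi>\<phi>
      by (simp add: power2_norm_eq_inner inner_diff_left inner_diff_right inner_commute[of \<phi> \<psi>]
          inner_eq_Re_cinner[of \<psi> \<phi>]) (simp flip: power2_norm_eq_inner)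
    then have "P = Q"
      using \<psi>(2) \<phi>(2) by simp
    then show thesis
      using that[of "\<lambda>_. P"] assms(1) d True by simp
  next
    case False
    then have s: "0 < sin \<theta>"
      using \<theta> pi_gt_zero by (intro sin_gt_zero) linarith+
    \<comment> \<open>Gram-Schmidt: the component of \<phi> orthogonal to \<psi> has norm sin
      \<theta>.\<close>
    define \<xi> where "\<xi> = inverse (sin \<theta>) *\<^sub>R (\<phi> - r *\<^sub>R \<psi>)"
    have \<phi>_eq: "\<phi> = cos \<theta> *\<^sub>R \<psi> + sin \<theta> *\<^sub>R \<xi>"
      using s by (simp add: \<xi>_def \<theta>)
    have \<psi>\<psi>: "cinner \<psi> \<psi> = 1" and \<phi>\<phi>: "cinner \<phi> \<phi> = 1"
      using \<psi> \<phi> by (simp_all add: cinner_self_1_iff)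
    have \<phi>\<psi>: "cinner \<phi> \<psi> = of_real r"
      using \<psi>\<phi> cinner_commute[of \<phi> \<psi>] by simp
    have \<psi>\<xi>: "cinner \<psi> \<xi> = 0" "cinner \<xi> \<psi> = 0"
      by (simp_all add: \<xi>_def cinner_scaleR_left cinner_scaleR_right cinner_diff_left cinner_diff_right
          \<psi>\<phi> \<phi>\<psi> \<psi>\<psi>)
    have "cinner (\<phi> - r *\<^sub>R \<psi>) (\<phi> - r *\<^sub>R \<psi>) = of_real ((sin \<theta>)\<^sup>2)"
      by (simp add: cinner_scaleR_left cinner_scaleR_right cinner_diff_left cinner_diff_right
          \<psi>\<phi> \<phi>\<psi> \<psi>\<psi> \<phi>\<phi> sin_squared_eq \<theta>(1) flip: power2_eq_square)
    then have \<xi>\<xi>: "cinner \<xi> \<xi> = 1"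
      using s unfolding \<xi>_def cinner_scaleR_left cinner_scaleR_right
      by (simp add: power2_eq_square field_simps)
    define \<gamma> where "\<gamma> t = cos (t * \<theta>) *\<^sub>R \<psi> + sin (t * \<theta>) *\<^sub>R \<xi>" for t
    have ip: "cinner (\<gamma> s) (\<gamma> t) = of_real (cos ((t - s) * \<theta>))" for s t
      by (simp add: \<gamma>_def cinner_add_left cinner_add_right cinner_scaleR_left cinner_scaleR_right
          \<psi>\<psi> \<xi>\<xi> \<psi>\<xi> left_diff_distrib cos_diff flip: cos_of_real sin_of_real)
    have n\<gamma>: "norm (\<gamma> t) = 1" for t
      using ip[of t t] by (simp add: cinner_self_1_iff[symmetric])
    show thesis
    proof (rule that[of "\<lambda>t. proj (\<gamma> t)"])
      show "proj (\<gamma> 0) = P" "proj (\<gamma> 1) = Q"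
        using \<psi> \<phi> by (simp_all add: \<gamma>_def flip: \<phi>_eq)
      show "proj (\<gamma> t) \<in> pure_states" for t
        using n\<gamma> by (simp add: pure_states_eq)
      fix s t :: real assume st: "s \<in> {0..1}" "t \<in> {0..1}"
      have le: "\<bar>t - s\<bar> * \<theta> \<le> \<theta>"
        using st \<theta>(2) by (intro mult_left_le_one_le) auto
      have "cos ((t - s) * \<theta>) = cos (\<bar>t - s\<bar> * \<theta>)"
        by (cases "s \<le> t") (auto simp: cos_minus abs_if algebra_simps, metis cos_minus minus_diff_eq)
      moreover have "0 \<le> cos (\<bar>t - s\<bar> * \<theta>)"
        using le \<theta> by (intro cos_ge_zero) (auto intro: order_trans[of _ 0])
      ultimately have "cmod (cinner (\<gamma> s) (\<gamma> t)) = cos (\<bar>t - s\<bar> * \<theta>)"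
        by (simp add: ip)
      then show "d_FS (proj (\<gamma> s)) (proj (\<gamma> t)) = \<bar>t - s\<bar> * d_FS P Q"
        using le \<theta> pi_gt_zero by (simp add: d_FS_proj[OF n\<gamma> n\<gamma>] d arccos_cos)
    qed
  qed
qed

section \<open>Radon probability measures and couplings\<close>

text \<open>Finite Borel measures on a Polish space are inner regular. The measure lives on the
  trace sigma-algebra of E, so it is pushed to the whole space along the inclusion before this is
  applied; closedness makes E Borel.\<close>

lemma radon_probI:
  fixes E :: "'a::{second_countable_topology, complete_space} set"
  assumes "closed E" "prob_space \<mu>" and sets: "sets \<mu> = sets (restrict_space borel E)"
  shows "\<mu> \<in> radon_prob E"
  unfolding radon_prob_def
proof (intro CollectI conjI assms ballI)
  fix A assume A: "A \<in> sets \<mu>"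
  interpret prob_space \<mu> by fact
  define N where "N = distr \<mu> borel (\<lambda>x. x)"
  have m: "(\<lambda>x. x) \<in> \<mu> \<rightarrow>\<^sub>M borel"
    using sets by (simp add: measurable_cong_sets[OF sets refl] measurable_restrict_space1)
  interpret N: prob_space N
    unfolding N_def by (rule prob_space_distr[OF m])
  have E: "E \<in> sets borel"
    using assms(1) by (rule borel_closed)
  have space: "space \<mu> = E"
    using sets_eq_imp_space_eq[OF sets] by (simp add: space_restrict_space)
  have *: "emeasure N B = emeasure \<mu> B" if "B \<subseteq> E" "B \<in> sets borel" for B
    using that space by (simp add: N_def emeasure_distr[OF m] Int_absorb2)
  have A': "A \<subseteq> E" "A \<in> sets borel"
    using A E unfolding sets by (simp_all add: sets_restrict_space_iff)
  have "emeasure \<mu> A = (SUP K\<in>{K. K \<subseteq> A \<and> compact K}. emeasure N K)"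
    using inner_regular[of N A] A' * by (simp add: N_def N.emeasure_finite[unfolded N_def])
  also have "\<dots> = (SUP K\<in>{K. K \<subseteq> A \<and> compact K}. emeasure \<mu> K)"
    using A' * by (intro SUP_cong refl) (auto intro: borel_compact)
  finally show "emeasure \<mu> A = (SUP K\<in>{K. K \<subseteq> A \<and> compact K}. emeasure \<mu> K)" .
qed

lemma radon_probD:
  assumes "\<mu> \<in> radon_prob E"
  shows "prob_space \<mu>" "sets \<mu> = sets (restrict_space borel E)" "space \<mu> = E"
proof -
  show "prob_space \<mu>" and *: "sets \<mu> = sets (restrict_space borel E)"
    using assms by (auto simp: radon_prob_def)
  show "space \<mu> = E"
    using sets_eq_imp_space_eq[OF *] by (simp add: space_restrict_space)
qed

lemma radon_prob_distr:
  fixes E' :: "'b::{second_countable_topology, complete_space} set"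
  assumes "prob_space M" "g \<in> M \<rightarrow>\<^sub>M restrict_space borel E'" "closed E'"
  shows "distr M (restrict_space borel E') g \<in> radon_prob E'"
  using assms by (intro radon_probI prob_space.prob_space_distr) auto

lemma measurable_radon_restrict:
  assumes "\<mu> \<in> radon_prob E" "continuous_on E f" "f ` E \<subseteq> E'"
  shows "f \<in> \<mu> \<rightarrow>\<^sub>M restrict_space borel E'"
  using assms radon_probD[OF assms(1)] borel_measurable_continuous_on_restrict[OF assms(2)]
  by (intro measurable_restrict_space2) (auto simp: measurable_cong_sets[OF radon_probD(2)[OF assms(1)] refl])

lemma measurable_radon:
  assumes "\<mu> \<in> radon_prob E" "continuous_on E f"
  shows "f \<in> borel_measurable \<mu>"
  using borel_measurable_continuous_on_restrict[OF assms(2)]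
  by (simp add: measurable_cong_sets[OF radon_probD(2)[OF assms(1)] refl])

lemma integrable_radon:
  fixes f :: "_ \<Rightarrow> 'b::{banach, second_countable_topology}"
  assumes "\<mu> \<in> radon_prob E" "continuous_on E f" "compact E"
  shows "integrable \<mu> f"
proof -
  interpret prob_space \<mu>
    using radon_probD(1)[OF assms(1)] .
  obtain B where "\<And>x. x \<in> E \<Longrightarrow> norm (f x) \<le> B"
    using compact_imp_bounded[OF compact_continuous_image[OF assms(2,3)]] by (auto simp: bounded_iff)
  then show ?thesis
    using radon_probD(3)[OF assms(1)] measurable_radon[OF assms(1,2)]
    by (intro integrable_const_bound[where B = B]) (auto intro: AE_I2)
qed

lemma couplings_marginals:
  fixes E :: "'a::{second_countable_topology, complete_space} set"
  assumes "\<pi> \<in> radon_prob (E \<times> E)" "closed E"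
  shows "distr \<pi> (restrict_space borel E) fst \<in> radon_prob E"
    "distr \<pi> (restrict_space borel E) snd \<in> radon_prob E"
  using assms radon_probD(1)[OF assms(1)]
  by (auto intro!: radon_prob_distr measurable_radon_restrict[OF assms(1)] continuous_intros)

text \<open>The product measure is a coupling. Nonemptiness matters because the infimum of an empty
  set of reals is a default value. Second countability lets the product sigma-algebra see the Borel
  sets of the product.\<close>

lemma couplings_nonempty:
  fixes E :: "'a::{second_countable_topology, complete_space} set"
  assumes \<mu>: "\<mu> \<in> radon_prob E" and \<nu>: "\<nu> \<in> radon_prob E" and E: "closed E"
  shows "couplings E \<mu> \<nu> \<noteq> {}"
proof -
  interpret \<mu>: prob_space \<mu> using radon_probD(1)[OF \<mu>] .
  interpret \<nu>: prob_space \<nu> using radon_probD(1)[OF \<nu>] .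
  interpret pair_prob_space \<mu> \<nu> ..
  interpret sw: pair_prob_space \<nu> \<mu> ..
  let ?R = "restrict_space borel E"
  have id: "(\<lambda>z. z) \<in> \<mu> \<Otimes>\<^sub>M \<nu> \<rightarrow>\<^sub>M restrict_space borel (E \<times> E)"
  proof (rule measurable_restrict_space2)
    show "(\<lambda>z. z) \<in> space (\<mu> \<Otimes>\<^sub>M \<nu>) \<rightarrow> E \<times> E"
      by (auto simp: space_pair_measure radon_probD(3)[OF \<mu>] radon_probD(3)[OF \<nu>])
    have "(\<lambda>x. x) \<in> borel_measurable \<mu>" "(\<lambda>x. x) \<in> borel_measurable \<nu>"
      using measurable_radon[OF \<mu> continuous_on_id] measurable_radon[OF \<nu> continuous_on_id] by auto
    then have "(\<lambda>z. (fst z, snd z)) \<in> borel_measurable (\<mu> \<Otimes>\<^sub>M \<nu>)"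
      by (intro borel_measurable_Pair measurable_compose[OF measurable_fst]
          measurable_compose[OF measurable_snd])
    then show "(\<lambda>z. z) \<in> borel_measurable (\<mu> \<Otimes>\<^sub>M \<nu>)"
      by simp
  qed
  define \<pi> where "\<pi> = distr (\<mu> \<Otimes>\<^sub>M \<nu>) (restrict_space borel (E \<times> E)) (\<lambda>z. z)"
  have \<pi>: "\<pi> \<in> radon_prob (E \<times> E)"
    unfolding \<pi>_def using E id by (intro radon_prob_distr closed_Times) (auto intro: P.prob_space_axioms)
  have m: "fst \<in> restrict_space borel (E \<times> E) \<rightarrow>\<^sub>M ?R" "snd \<in> restrict_space borel (E \<times> E) \<rightarrow>\<^sub>M ?R"
    using measurable_radon_restrict[OF \<pi>, of fst E] measurable_radon_restrict[OF \<pi>, of snd E]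
    by (auto simp: continuous_on_fst continuous_on_snd measurable_cong_sets[OF radon_probD(2)[OF \<pi>] refl])
  have "distr \<pi> ?R fst = distr (\<mu> \<Otimes>\<^sub>M \<nu>) ?R fst"
    unfolding \<pi>_def by (subst distr_distr[OF m(1) id]) (simp add: comp_def)
  also have "\<dots> = distr (\<mu> \<Otimes>\<^sub>M \<nu>) \<mu> fst"
    using radon_probD(2)[OF \<mu>] by (intro distr_cong) auto
  finally have 1: "distr \<pi> ?R fst = \<mu>"
    by (simp add: \<nu>.distr_pair_fst)
  have "distr \<pi> ?R snd = distr (\<mu> \<Otimes>\<^sub>M \<nu>) ?R snd"
    unfolding \<pi>_def by (subst distr_distr[OF m(2) id]) (simp add: comp_def)
  also have "\<dots> = distr (\<mu> \<Otimes>\<^sub>M \<nu>) \<nu> snd"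
    using radon_probD(2)[OF \<nu>] by (intro distr_cong) auto
  \<comment> \<open>The second marginal becomes a first marginal once the factors are
    exchanged.\<close>
  also have "\<dots> = distr (\<nu> \<Otimes>\<^sub>M \<mu>) \<nu> (snd \<circ> (\<lambda>(x, y). (y, x)))"
    by (subst distr_pair_swap) (simp add: distr_distr)
  also have "snd \<circ> (\<lambda>(x, y). (y, x)) = (fst :: 'a \<times> 'a \<Rightarrow> 'a)"
    by auto
  finally have 2: "distr \<pi> ?R snd = \<nu>"
    by (simp add: \<mu>.distr_pair_fst)
  show ?thesis
    using \<pi> 1 2 by (auto simp: couplings_def)
qed

lemma couplings_swap:
  fixes E :: "'a::{second_countable_topology, complete_space} set"
  assumes \<pi>: "\<pi> \<in> couplings E \<mu> \<nu>" and E: "closed E"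
  defines "\<pi>' \<equiv> distr \<pi> (restrict_space borel (E \<times> E)) prod.swap"
  shows "\<pi>' \<in> couplings E \<nu> \<mu>"
    and "\<And>f :: 'a \<times> 'a \<Rightarrow> 'b::{banach, second_countable_topology}.
      continuous_on (E \<times> E) f \<Longrightarrow> (\<integral>z. f z \<partial>\<pi>') = (\<integral>z. f (snd z, fst z) \<partial>\<pi>)"
proof -
  have r: "\<pi> \<in> radon_prob (E \<times> E)" and marg: "distr \<pi> (restrict_space borel E) fst = \<mu>"
    "distr \<pi> (restrict_space borel E) snd = \<nu>"
    using \<pi> by (auto simp: couplings_def)
  have sw: "prod.swap \<in> \<pi> \<rightarrow>\<^sub>M restrict_space borel (E \<times> E)"
    by (rule measurable_radon_restrict[OF r]) (auto simp: prod.swap_def intro!: continuous_intros)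
  have r': "\<pi>' \<in> radon_prob (E \<times> E)"
    unfolding \<pi>'_def using E sw radon_probD(1)[OF r] by (intro radon_prob_distr closed_Times) auto
  have m: "fst \<in> restrict_space borel (E \<times> E) \<rightarrow>\<^sub>M restrict_space borel E"
    "snd \<in> restrict_space borel (E \<times> E) \<rightarrow>\<^sub>M restrict_space borel E"
    using measurable_radon_restrict[OF r, of fst E] measurable_radon_restrict[OF r, of snd E]
    by (auto simp: continuous_on_fst continuous_on_snd measurable_cong_sets[OF radon_probD(2)[OF r] refl])
  have "distr \<pi>' (restrict_space borel E) fst = \<nu>" "distr \<pi>' (restrict_space borel E) snd = \<mu>"
    unfolding \<pi>'_def marg[symmetric] distr_distr[OF m(1) sw] distr_distr[OF m(2) sw]
    by (simp_all add: comp_def)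
  then show "\<pi>' \<in> couplings E \<nu> \<mu>"
    using r' by (simp add: couplings_def)
  fix f :: "'a \<times> 'a \<Rightarrow> 'b" assume "continuous_on (E \<times> E) f"
  then have "f \<in> borel_measurable (restrict_space borel (E \<times> E))"
    by (rule borel_measurable_continuous_on_restrict)
  then show "(\<integral>z. f z \<partial>\<pi>') = (\<integral>z. f (snd z, fst z) \<partial>\<pi>)"
    unfolding \<pi>'_def by (subst integral_distr[OF sw]) (auto simp: prod.swap_def)
qed

text \<open>A finite sum of weighted Dirac measures, written as an image from an index set so that
  an index may carry more than its location: in \<open>d_star_le_plan\<close> it also contains the
  cost.\<close>

definition discrete_measure ::
    "'a::topological_space set \<Rightarrow> 'i set \<Rightarrow> ('i \<Rightarrow> real) \<Rightarrow> ('i \<Rightarrow> 'a) \<Rightarrow> 'a measure"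
  where "discrete_measure E F u g =
    distr (point_measure F (\<lambda>x. ennreal (u x))) (restrict_space borel E) g"

lemma discrete_measure_radon_prob:
  fixes E :: "'a::{second_countable_topology, complete_space} set"
  assumes "finite F" "\<And>x. x \<in> F \<Longrightarrow> 0 \<le> u x" "sum u F = 1" "\<And>x. x \<in> F \<Longrightarrow> g x \<in> E" "closed E"
  shows "discrete_measure E F u g \<in> radon_prob E"
  unfolding discrete_measure_def
proof (rule radon_prob_distr)
  let ?M = "point_measure F (\<lambda>x. ennreal (u x))"
  have "emeasure ?M F = ennreal (sum u F)"
    using assms by (subst emeasure_point_measure_finite2) (auto simp: sum_ennreal)
  then show "prob_space ?M"
    using assms by (intro prob_spaceI) (simp add: space_point_measure)
  show "g \<in> ?M \<rightarrow>\<^sub>M restrict_space borel E"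
    using assms by (auto simp: space_restrict_space)
qed fact

lemma integral_discrete_measure:
  fixes f :: "'a::topological_space \<Rightarrow> 'b::{banach, second_countable_topology}"
  assumes "finite F" "\<And>x. x \<in> F \<Longrightarrow> 0 \<le> u x" "\<And>x. x \<in> F \<Longrightarrow> g x \<in> E" "continuous_on E f"
  shows "(\<integral>z. f z \<partial>discrete_measure E F u g) = (\<Sum>x\<in>F. u x *\<^sub>R f (g x))"
proof -
  have "g \<in> point_measure F (\<lambda>x. ennreal (u x)) \<rightarrow>\<^sub>M restrict_space borel E"
    using assms by (auto simp: space_restrict_space)
  then show ?thesis
    unfolding discrete_measure_def using assms
    by (subst integral_distr[OF _ borel_measurable_continuous_on_restrict[OF assms(4)]])
      (auto simp: lebesgue_integral_point_measure_finite)
qed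

text \<open>X is rounded to a finite net of K. The integral of the rounded function is a convex
  combination of net points, weighted by the probabilities of the cells, and is within e / 2 of the
  integral of X.\<close>

lemma integral_in_closure_convex_hull:
  fixes X :: "'b \<Rightarrow> 'a::{banach, second_countable_topology}"
  assumes "prob_space M" and X: "X \<in> borel_measurable M"
    and K: "\<And>z. z \<in> space M \<Longrightarrow> X z \<in> K" "compact K"
  shows "(\<integral>z. X z \<partial>M) \<in> closure (convex hull K)"
  unfolding closure_approachable
proof (intro allI impI)
  interpret prob_space M by fact
  fix e :: real assume "0 < e"
  obtain k where k: "finite k" "k \<subseteq> K" "K \<subseteq> (\<Union>x\<in>k. ball x (e / 2))"
    using seq_compact_imp_totally_bounded[OF compact_imp_seq_compact[OF K(2)]] \<open>0 < e\<close>
    by (metis half_gt_zero)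
  obtain xs where xs: "set xs = k"
    using finite_list[OF k(1)] by blast
  define P where "P z i \<longleftrightarrow> i < length xs \<and> dist (xs ! i) (X z) < e / 2" for z i
  \<comment> \<open>Taking the least index makes the choice of a net point measurable.\<close>
  define q where "q z = (LEAST i. P z i)" for z
  have "\<exists>i. P z i" if z: "z \<in> space M" for z
  proof -
    obtain y where y: "y \<in> k" "dist y (X z) < e / 2"
      using K(1)[OF z] k(3) by auto
    then obtain i where "i < length xs" "xs ! i = y"
      using xs by (auto simp: in_set_conv_nth)
    then show ?thesis
      using y by (auto simp: P_def)
  qed
  then have P: "P z (q z)" if "z \<in> space M" for z
    unfolding q_def using that LeastI_ex by metis
  have [measurable]: "q \<in> M \<rightarrow>\<^sub>M count_space UNIV"
  proof -
    note X[measurable]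
    show ?thesis
      unfolding q_def P_def by measurable
  qed
  define A where "A i = {z \<in> space M. q z = i}" for i
  have A: "A i \<in> events" for i
    unfolding A_def by measurable
  define w where "w i = prob (A i)" for i
  define Y where "Y z = (\<Sum>i<length xs. indicator (A i) z *\<^sub>R xs ! i)" for z
  have Y: "Y z = xs ! q z" if "z \<in> space M" for z
  proof -
    have "Y z = (\<Sum>i<length xs. if i = q z then xs ! i else 0)"
      using that unfolding Y_def by (intro sum.cong) (auto simp: A_def)
    then show ?thesis
      using P[OF that] by (simp add: P_def)
  qed
  have intY: "has_bochner_integral M Y (\<Sum>i<length xs. w i *\<^sub>R xs ! i)"
    unfolding Y_def w_def using A
    by (intro has_bochner_integral_sum has_bochner_integral_scaleR_left has_bochner_integral_real_indicator)
      (auto simp: emeasure_eq_measure)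
  have "(\<Sum>i<length xs. w i) = 1"
  proof -
    have "(\<Sum>i<length xs. w i) = prob (\<Union>i<length xs. A i)"
      unfolding w_def using A
      by (intro finite_measure_finite_Union[symmetric]) (auto simp: disjoint_family_on_def A_def)
    also have "(\<Union>i<length xs. A i) = space M"
      using P by (auto simp: A_def P_def)
    finally show ?thesis
      by (simp add: prob_space)
  qed
  then have "(\<Sum>i<length xs. w i *\<^sub>R xs ! i) \<in> convex hull K"
    using xs k(2) by (intro convex_sum) (auto simp: w_def intro!: hull_inc)
  moreover have "dist (\<Sum>i<length xs. w i *\<^sub>R xs ! i) (\<integral>z. X z \<partial>M) < e"
  proof -
    obtain B where B: "\<And>x. x \<in> K \<Longrightarrow> norm x \<le> B"
      using compact_imp_bounded[OF K(2)] by (auto simp: bounded_iff)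
    have iX: "integrable M X"
      using B K(1) X by (intro integrable_const_bound[where B = B]) (auto intro: AE_I2)
    have iY: "integrable M Y" "(\<integral>z. Y z \<partial>M) = (\<Sum>i<length xs. w i *\<^sub>R xs ! i)"
      using intY by (auto simp: has_bochner_integral_iff)
    have "norm (\<integral>z. Y z - X z \<partial>M) \<le> (\<integral>z. norm (Y z - X z) \<partial>M)"
      by (rule integral_norm_bound)
    also have "\<dots> \<le> e / 2"
    proof (rule integral_le_const)
      show "integrable M (\<lambda>z. norm (Y z - X z))"
        using iX iY by simp
      show "AE z in M. norm (Y z - X z) \<le> e / 2"
        using P Y by (intro AE_I2) (auto simp: P_def dist_norm less_imp_le)
    qed
    also have "\<dots> < e"
      using \<open>0 < e\<close> by simp
    finally show ?thesis
      using iX iY by (simp add: dist_norm)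
  qed
  ultimately show "\<exists>y\<in>convex hull K. dist y (\<integral>z. X z \<partial>M) < e"
    by blast
qed

section \<open>The folded distance of a ground distance\<close>

lemma convex_combination3:
  assumes "convex C" "x \<in> C" "y \<in> C" "z \<in> C" "0 \<le> u" "0 \<le> v" "0 \<le> w" "u + v + w = 1"
  shows "u *\<^sub>R x + v *\<^sub>R y + w *\<^sub>R z \<in> C"
proof -
  have "(\<Sum>i<3::nat. (if i = 0 then u else if i = 1 then v else w) *\<^sub>R
      (if i = 0 then x else if i = 1 then y else z)) \<in> C"
    using assms by (intro convex_sum) (auto simp: numeral_3_eq_3)
  then show ?thesis
    by (simp add: numeral_3_eq_3)
qed

text \<open>Convexity is applied on the open half-line, where the power is differentiable; the
  remaining point x = 0 amounts to 1 \<le> p.\<close>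

lemma powr_above_tangent:
  fixes x a p :: real
  assumes "1 \<le> p" "0 < a" "0 \<le> x"
  shows "a powr p + p * a powr (p - 1) * (x - a) \<le> x powr p"
proof (cases "x = 0")
  case True
  have "a powr (p - 1) * a = a powr p"
    using assms powr_mult_base[of a "p - 1"] by (simp add: mult.commute)
  moreover have "1 * a powr p \<le> p * a powr p"
    using assms by (intro mult_right_mono) auto
  ultimately show ?thesis
    using True by (simp add: mult.assoc)
next
  case False
  have "p * a powr (p - 1) * (x - a) \<le> x powr p - a powr p"
  proof (rule convex_on_imp_above_tangent[OF powr_convex[OF assms(1)]])
    show "((\<lambda>x. x powr p) has_real_derivative p * a powr (p - 1)) (at a within {0<..})"
      using assms by (auto intro!: derivative_eq_intros)
  qed (use assms False in \<open>auto simp: interior_open\<close>)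
  then show ?thesis
    by simp
qed

text \<open>What the two distances share. The constant c is 1 for Frobenius and 2 powr (-1/2) for
  Fubini-Study, and reappears in \<open>D_lower\<close>. Continuity on a compact set makes the costs
  bounded and integrable.\<close>

locale ground_distance =
  fixes d :: "('a::fd_complex_hilbert \<Rightarrow>\<^sub>L 'a) \<Rightarrow> ('a \<Rightarrow>\<^sub>L 'a) \<Rightarrow> real" and p c :: real
  assumes p: "1 \<le> p" and c: "0 < c"
    and d_sym: "d P Q = d Q P"
    and d_self: "P \<in> pure_states \<Longrightarrow> d P P = 0"
    and d_cont: "continuous_on (pure_states \<times> pure_states) (\<lambda>z. d (fst z) (snd z))"
    and d_lower: "P \<in> pure_states \<Longrightarrow> Q \<in> pure_states \<Longrightarrow> c * hs_norm (P - Q) \<le> d P Q"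
begin

lemma d_nonneg: "P \<in> pure_states \<Longrightarrow> Q \<in> pure_states \<Longrightarrow> 0 \<le> d P Q"
  using d_lower[of P Q] c by (meson hs_norm_nonneg less_imp_le mult_nonneg_nonneg order_trans)

definition cost :: "('a \<Rightarrow>\<^sub>L 'a) \<times> ('a \<Rightarrow>\<^sub>L 'a) \<Rightarrow> real"
  where "cost z = d (fst z) (snd z) powr p"

lemma cost_nonneg: "0 \<le> cost z"
  by (simp add: cost_def)

lemma continuous_on_cost: "continuous_on (pure_states \<times> pure_states) cost"
  unfolding cost_def using p d_nonneg
  by (intro continuous_on_powr' d_cont continuous_on_const) (auto simp: mem_Times_iff)

lemma cost_bounded:
  obtains C where "0 \<le> C" "\<And>z. z \<in> pure_states \<times> pure_states \<Longrightarrow> cost z \<le> C"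
proof -
  have "bounded (cost ` (pure_states \<times> pure_states))"
    by (intro compact_imp_bounded compact_continuous_image continuous_on_cost compact_Times
        compact_pure_states)
  then obtain C where "\<And>z. z \<in> pure_states \<times> pure_states \<Longrightarrow> \<bar>cost z\<bar> \<le> C"
    by (auto simp: bounded_iff)
  then show thesis
    by (intro that[of "max C 0"]) (auto intro: max.coboundedI1[OF abs_le_D1])
qed

text \<open>
  The triples \<open>((\<rho>, \<sigma>), x)\<close> such that a finitely supported coupling of decompositions of \<open>\<rho>\<close>
  and \<open>\<sigma>\<close> has transport cost \<open>x\<close>.
\<close>

definition plans :: "((('a \<Rightarrow>\<^sub>L 'a) \<times> ('a \<Rightarrow>\<^sub>L 'a)) \<times> real) set"
  where "plans = convex hull ((\<lambda>z. (z, cost z)) ` (pure_states \<times> pure_states))"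

lemma plans_subset:
  assumes "\<And>z. z \<in> pure_states \<times> pure_states \<Longrightarrow> cost z \<le> C"
  shows "plans \<subseteq> (density_ops \<times> density_ops) \<times> {0..C}"
  unfolding plans_def
  by (intro hull_minimal convex_Times convex_density_ops)
    (use assms cost_nonneg pure_states_subset_density_ops in auto)

lemma plans_density: "((\<rho>, \<sigma>), x) \<in> plans \<Longrightarrow> \<rho> \<in> density_ops \<and> \<sigma> \<in> density_ops \<and> 0 \<le> x"
proof -
  assume *: "((\<rho>, \<sigma>), x) \<in> plans"
  obtain C where "\<And>z. z \<in> pure_states \<times> pure_states \<Longrightarrow> cost z \<le> C"
    using cost_bounded by blast
  from subsetD[OF plans_subset[OF this] *] show ?thesis
    by simp
qed

text \<open>Convex hulls commute with linear maps and with products, so forgetting the cost maps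
  \<open>plans\<close> onto all pairs of density operators.\<close>

lemma plans_exists:
  assumes "\<rho> \<in> density_ops" "\<sigma> \<in> density_ops"
  obtains x where "((\<rho>, \<sigma>), x) \<in> plans"
proof -
  have "fst ` plans = convex hull (fst ` ((\<lambda>z. (z, cost z)) ` (pure_states \<times> pure_states)))"
    unfolding plans_def by (rule convex_hull_linear_image) (rule linear_fst)
  also have "\<dots> = density_ops \<times> density_ops"
    by (simp add: image_image convex_hull_Times density_ops_eq_hull)
  finally have "(\<rho>, \<sigma>) \<in> fst ` plans"
    using assms by simp
  then show thesis
    using that by auto
qed

lemma plans_diag:
  assumes "\<rho> \<in> density_ops"
  shows "((\<rho>, \<rho>), 0) \<in> plans"
proof -
  have "linear (\<lambda>P::'a \<Rightarrow>\<^sub>L 'a. ((P, P), 0::real))"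
    by (intro linearI) auto
  then have "(\<lambda>P::'a \<Rightarrow>\<^sub>L 'a. ((P, P), 0::real)) ` density_ops = convex hull ((\<lambda>P. ((P, P), 0)) ` pure_states)"
    unfolding density_ops_eq_hull by (rule convex_hull_linear_image)
  also have "\<dots> \<subseteq> plans"
    unfolding plans_def using p by (intro hull_mono) (auto simp: cost_def d_self image_iff)
  finally show ?thesis
    using assms by blast
qed

lemma plans_convex: "convex plans"
  by (simp add: plans_def)

text \<open>The share 1 - \<epsilon> stays at rest and the share \<epsilon> moves from \<rho> to
  \<eta>. The cost is a p-th power, so this linear bound turns into the exponent 1 / p for the
  distance.\<close>

lemma plans_mixture:
  assumes "\<rho> \<in> density_ops" "\<eta> \<in> density_ops" "0 \<le> \<epsilon>" "\<epsilon> \<le> 1"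
    and C: "\<And>z. z \<in> pure_states \<times> pure_states \<Longrightarrow> cost z \<le> C"
  obtains x where "0 \<le> x" "x \<le> \<epsilon> * C" "((\<rho>, (1 - \<epsilon>) *\<^sub>R \<rho> + \<epsilon> *\<^sub>R \<eta>), x) \<in> plans"
proof -
  obtain x where x: "((\<rho>, \<eta>), x) \<in> plans"
    using plans_exists[OF assms(1,2)] .
  have "0 \<le> x" "x \<le> C"
    using x plans_subset[OF C] by auto
  moreover have "(1 - \<epsilon>) *\<^sub>R ((\<rho>, \<rho>), 0) + \<epsilon> *\<^sub>R ((\<rho>, \<eta>), x) \<in> plans"
    using assms x by (intro convexD[OF plans_convex] plans_diag) auto
  then have "((\<rho>, (1 - \<epsilon>) *\<^sub>R \<rho> + \<epsilon> *\<^sub>R \<eta>), \<epsilon> * x) \<in> plans"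
    by (simp flip: scaleR_add_left)
  ultimately show thesis
    using that[of "\<epsilon> * x"] assms by (auto intro: mult_left_mono)
qed

section \<open>Bounds on \<open>d_star\<close>\<close>

lemma pure_decomps_nonempty:
  assumes "\<rho> \<in> density_ops"
  shows "pure_decomps \<rho> \<noteq> {}"
proof -
  obtain F u where F: "finite F" "F \<subseteq> pure_states" "\<forall>x\<in>F. 0 \<le> u x" "sum u F = 1"
    "(\<Sum>v\<in>F. u v *\<^sub>R v) = \<rho>"
    using assms unfolding density_ops_eq_hull convex_hull_explicit by blast
  have "discrete_measure pure_states F u (\<lambda>x. x) \<in> radon_prob pure_states"
    using F compact_imp_closed[OF compact_pure_states] by (intro discrete_measure_radon_prob) auto
  moreover have "(\<integral>P. P \<partial>discrete_measure pure_states F u (\<lambda>x. x)) = \<rho>"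
    using F by (subst integral_discrete_measure) auto
  ultimately show ?thesis
    by (auto simp: pure_decomps_def)
qed

lemma wasserstein_nonneg:
  assumes "\<mu> \<in> pure_decomps \<rho>" "\<nu> \<in> pure_decomps \<sigma>"
  shows "0 \<le> wasserstein pure_states d p \<mu> \<nu>"
  unfolding wasserstein_def using assms compact_imp_closed[OF compact_pure_states]
  by (intro cINF_greatest couplings_nonempty) (auto simp: pure_decomps_def)

text \<open>With \<open>d_star_less_cost\<close> this replaces three nested infima by one over
  couplings; all of them are bounded below by 0 and range over nonempty sets.\<close>

lemma d_star_le_cost:
  assumes \<mu>: "\<mu> \<in> pure_decomps \<rho>" and \<nu>: "\<nu> \<in> pure_decomps \<sigma>" and \<pi>: "\<pi> \<in> couplings pure_states \<mu> \<nu>"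
  shows "d_star d p \<rho> \<sigma> \<le> (\<integral>z. cost z \<partial>\<pi>) powr (1 / p)"
proof -
  have "d_star d p \<rho> \<sigma> \<le> (INF \<nu>\<in>pure_decomps \<sigma>. wasserstein pure_states d p \<mu> \<nu>)"
    unfolding d_star_def
    by (intro cINF_lower bdd_belowI2[where m = 0] cINF_greatest wasserstein_nonneg \<mu>) (use \<nu> in auto)
  also have "\<dots> \<le> wasserstein pure_states d p \<mu> \<nu>"
    by (intro cINF_lower bdd_belowI2[where m = 0] wasserstein_nonneg[OF \<mu>] \<nu>)
  also have "\<dots> \<le> (\<integral>z. cost z \<partial>\<pi>) powr (1 / p)"
    unfolding wasserstein_def cost_def by (intro cINF_lower bdd_belowI2[where m = 0] \<pi>) auto
  finally show ?thesis .
qed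

lemma d_star_less_cost:
  assumes "\<rho> \<in> density_ops" "\<sigma> \<in> density_ops" "d_star d p \<rho> \<sigma> < r"
  obtains \<mu> \<nu> \<pi> where "\<mu> \<in> pure_decomps \<rho>" "\<nu> \<in> pure_decomps \<sigma>" "\<pi> \<in> couplings pure_states \<mu> \<nu>"
    "(\<integral>z. cost z \<partial>\<pi>) powr (1 / p) < r"
proof -
  obtain \<mu> where \<mu>: "\<mu> \<in> pure_decomps \<rho>"
    "(INF \<nu>\<in>pure_decomps \<sigma>. wasserstein pure_states d p \<mu> \<nu>) < r"
    using cInf_lessD[OF _ assms(3)[unfolded d_star_def]] pure_decomps_nonempty[OF assms(1)] by auto
  obtain \<nu> where \<nu>: "\<nu> \<in> pure_decomps \<sigma>" "wasserstein pure_states d p \<mu> \<nu> < r"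
    using cInf_lessD[OF _ \<mu>(2)] pure_decomps_nonempty[OF assms(2)] by auto
  have "couplings pure_states \<mu> \<nu> \<noteq> {}"
    using \<mu>(1) \<nu>(1) compact_imp_closed[OF compact_pure_states]
    by (intro couplings_nonempty) (auto simp: pure_decomps_def)
  then obtain \<pi> where "\<pi> \<in> couplings pure_states \<mu> \<nu>" "(\<integral>z. cost z \<partial>\<pi>) powr (1 / p) < r"
    using cInf_lessD[OF _ \<nu>(2)[unfolded wasserstein_def]] by (auto simp: cost_def)
  then show thesis
    using that \<mu>(1) \<nu>(1) by blast
qed

lemma coupling_marginal_integrals:
  fixes \<rho> \<sigma> :: "'a \<Rightarrow>\<^sub>L 'a"
  assumes "\<pi> \<in> couplings pure_states \<mu> \<nu>" "\<mu> \<in> pure_decomps \<rho>" "\<nu> \<in> pure_decomps \<sigma>"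
  shows "(\<integral>z. fst z \<partial>\<pi>) = \<rho>" "(\<integral>z. snd z \<partial>\<pi>) = \<sigma>"
proof -
  have r: "\<pi> \<in> radon_prob (pure_states \<times> pure_states)"
    and marg: "distr \<pi> (restrict_space borel pure_states) fst = \<mu>"
    "distr \<pi> (restrict_space borel pure_states) snd = \<nu>"
    using assms(1) by (auto simp: couplings_def)
  have m: "fst \<in> \<pi> \<rightarrow>\<^sub>M restrict_space borel pure_states" "snd \<in> \<pi> \<rightarrow>\<^sub>M restrict_space borel pure_states"
    by (auto intro!: measurable_radon_restrict[OF r] continuous_intros)
  have id: "(\<lambda>P::'a \<Rightarrow>\<^sub>L 'a. P) \<in> borel_measurable (restrict_space borel pure_states)"
    by (intro borel_measurable_continuous_on_restrict continuous_on_id)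
  have "(\<integral>P. P \<partial>\<mu>) = (\<integral>z. fst z \<partial>\<pi>)" "(\<integral>P. P \<partial>\<nu>) = (\<integral>z. snd z \<partial>\<pi>)"
    unfolding marg[symmetric] by (rule integral_distr[OF m(1) id], rule integral_distr[OF m(2) id])
  then show "(\<integral>z. fst z \<partial>\<pi>) = \<rho>" "(\<integral>z. snd z \<partial>\<pi>) = \<sigma>"
    using assms(2,3) by (auto simp: pure_decomps_def)
qed

text \<open>The weights of a convex combination become the masses of an atomic coupling, whose
  marginals supply the decompositions.\<close>

lemma d_star_le_plan:
  assumes "((\<rho>, \<sigma>), x) \<in> plans"
  shows "d_star d p \<rho> \<sigma> \<le> x powr (1 / p)"
proof -
  let ?E = "pure_states :: ('a \<Rightarrow>\<^sub>L 'a) set"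
  have E: "closed ?E"
    by (rule compact_imp_closed[OF compact_pure_states])
  obtain F u where F: "finite F" "F \<subseteq> (\<lambda>z. (z, cost z)) ` (?E \<times> ?E)" "\<forall>x\<in>F. 0 \<le> u x" "sum u F = 1"
    "(\<Sum>v\<in>F. u v *\<^sub>R v) = ((\<rho>, \<sigma>), x)"
    using assms unfolding plans_def convex_hull_explicit by blast
  have FE: "fst v \<in> ?E \<times> ?E" "cost (fst v) = snd v" if "v \<in> F" for v
    using F(2) that by auto
  define \<pi> where "\<pi> = discrete_measure (?E \<times> ?E) F u fst"
  have r: "\<pi> \<in> radon_prob (?E \<times> ?E)"
    unfolding \<pi>_def using F FE E by (intro discrete_measure_radon_prob closed_Times) auto
  have int: "(\<integral>z. f z \<partial>\<pi>) = (\<Sum>v\<in>F. u v *\<^sub>R f (fst v))" if "continuous_on (?E \<times> ?E) f"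
    for f :: "_ \<Rightarrow> 'b::{banach, second_countable_topology}"
    unfolding \<pi>_def using F FE that by (intro integral_discrete_measure) auto
  have E_cont: "continuous_on (?E \<times> ?E) fst" "continuous_on (?E \<times> ?E) snd"
    by (intro continuous_intros)+
  have "(\<integral>z. fst z \<partial>\<pi>) = fst (fst (\<Sum>v\<in>F. u v *\<^sub>R v))"
    by (simp add: int E_cont fst_sum)
  then have 1: "(\<integral>z. fst z \<partial>\<pi>) = \<rho>"
    by (simp add: F)
  have "(\<integral>z. snd z \<partial>\<pi>) = snd (fst (\<Sum>v\<in>F. u v *\<^sub>R v))"
    by (simp add: int E_cont fst_sum snd_sum)
  then have 2: "(\<integral>z. snd z \<partial>\<pi>) = \<sigma>"
    by (simp add: F)
  have "(\<integral>z. cost z \<partial>\<pi>) = snd (\<Sum>v\<in>F. u v *\<^sub>R v)"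
    by (simp add: int continuous_on_cost snd_sum FE)
  then have 3: "(\<integral>z. cost z \<partial>\<pi>) = x"
    by (simp add: F)
  have m: "fst \<in> \<pi> \<rightarrow>\<^sub>M restrict_space borel ?E" "snd \<in> \<pi> \<rightarrow>\<^sub>M restrict_space borel ?E"
    by (auto intro!: measurable_radon_restrict[OF r] continuous_intros)
  have id: "(\<lambda>P::'a \<Rightarrow>\<^sub>L 'a. P) \<in> borel_measurable (restrict_space borel ?E)"
    by (intro borel_measurable_continuous_on_restrict continuous_on_id)
  have "distr \<pi> (restrict_space borel ?E) fst \<in> pure_decomps \<rho>"
    using couplings_marginals(1)[OF r E] integral_distr[OF m(1) id] 1 by (simp add: pure_decomps_def)
  moreover have "distr \<pi> (restrict_space borel ?E) snd \<in> pure_decomps \<sigma>"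
    using couplings_marginals(2)[OF r E] integral_distr[OF m(2) id] 2 by (simp add: pure_decomps_def)
  ultimately show ?thesis
    using d_star_le_cost[of _ \<rho> _ \<sigma> \<pi>] r 3 by (simp add: couplings_def)
qed

text \<open>Pairing with \<rho> - \<sigma> and Cauchy-Schwarz bound the ground distance below by a
  linear function of z whose integral is a = c * hs_norm (\<rho> - \<sigma>). The tangent of the
  p-th power at a carries this over to the cost: Jensen's inequality with one explicit
  tangent.\<close>

lemma d_star_lower:
  assumes \<rho>: "\<rho> \<in> density_ops" and \<sigma>: "\<sigma> \<in> density_ops"
  shows "c * hs_norm (\<rho> - \<sigma>) \<le> d_star d p \<rho> \<sigma>"
proof (rule ccontr)
  define h where "h = hs_norm (\<rho> - \<sigma>)"
  define a where "a = c * h"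
  assume "\<not> ?thesis"
  then have less: "d_star d p \<rho> \<sigma> < a"
    by (simp add: a_def h_def)
  obtain \<mu> \<nu> \<pi> where *: "\<mu> \<in> pure_decomps \<rho>" "\<nu> \<in> pure_decomps \<sigma>"
    "\<pi> \<in> couplings pure_states \<mu> \<nu>" "(\<integral>z. cost z \<partial>\<pi>) powr (1 / p) < a"
    using d_star_less_cost[OF \<rho> \<sigma> less] .
  \<comment> \<open>A nonnegative power lies below a; this is what permits the division by
    h.\<close>
  have "0 < a"
    using *(4) powr_ge_zero le_less_trans by blast
  then have "0 < h"
    using c by (simp add: a_def zero_less_mult_iff)
  have r: "\<pi> \<in> radon_prob (pure_states \<times> pure_states)"
    using *(3) by (auto simp: couplings_def)
  interpret prob_space \<pi>
    using radon_probD(1)[OF r] .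
  note int = integrable_radon[OF r _ compact_Times[OF compact_pure_states compact_pure_states]]
  have ifst: "integrable \<pi> fst" and isnd: "integrable \<pi> snd"
    by (auto intro!: int continuous_intros)
  define l where "l z = hs_inner (fst z - snd z) (\<rho> - \<sigma>)" for z
  have "has_bochner_integral \<pi> (\<lambda>z. fst z - snd z) (\<rho> - \<sigma>)"
    using ifst isnd coupling_marginal_integrals[OF *(3,1,2)]
    by (auto simp: has_bochner_integral_iff)
  then have "has_bochner_integral \<pi> l (hs_inner (\<rho> - \<sigma>) (\<rho> - \<sigma>))"
    unfolding l_def
    by (rule has_bochner_integral_bounded_linear[OF bounded_linear_hs_inner])
  then have il: "integrable \<pi> l" "(\<integral>z. l z \<partial>\<pi>) = h\<^sup>2"
    by (auto simp: has_bochner_integral_iff hs_inner_self h_def)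
  define q where "q = p * a powr (p - 1)"
  have "0 \<le> q"
    using p by (simp add: q_def)
  \<comment> \<open>As a function of y = l z, the line k * y + b is the tangent at a evaluated at c
    * y / h; at y = h^2, the integral of l, its value is a powr p.\<close>
  define k b where "k = q * c / h" and "b = a powr p - q * a"
  have "(\<integral>z. k * l z + b \<partial>\<pi>) \<le> (\<integral>z. cost z \<partial>\<pi>)"
  proof (rule integral_mono)
    show "integrable \<pi> cost"
      by (rule int[OF continuous_on_cost])
    show "integrable \<pi> (\<lambda>z. k * l z + b)"
      by (intro Bochner_Integration.integrable_add integrable_mult_right integrable_const il(1))
    show "k * l z + b \<le> cost z" if "z \<in> space \<pi>" for z
proof -
    have z: "fst z \<in> pure_states" "snd z \<in> pure_states"
      using that unfolding radon_probD(3)[OF r] by (simp_all add: mem_Times_iff)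
    have "l z / h \<le> hs_norm (fst z - snd z)"
      using hs_inner_le[of "fst z - snd z" "\<rho> - \<sigma>"] \<open>0 < h\<close>
      by (simp add: l_def h_def field_simps)
    then have "c * (l z / h) \<le> d (fst z) (snd z)"
      using d_lower[OF z] c by (meson less_imp_le mult_left_mono order_trans)
    then have "a powr p + q * (c * (l z / h) - a) \<le> a powr p + q * (d (fst z) (snd z) - a)"
      using \<open>0 \<le> q\<close> by (intro add_left_mono mult_left_mono diff_right_mono)
    also have "\<dots> \<le> cost z"
      unfolding q_def cost_def using p \<open>0 < a\<close> d_nonneg[OF z] by (intro powr_above_tangent)
    also have "a powr p + q * (c * (l z / h) - a) = k * l z + b"
      by (simp add: k_def b_def algebra_simps)
    finally show ?thesis .
    qed
  qed
  moreover have "(\<integral>z. k * l z + b \<partial>\<pi>) = k * h\<^sup>2 + b"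
    using il prob_space by (subst Bochner_Integration.integral_add) auto
  moreover have "k * h\<^sup>2 + b = a powr p"
    using \<open>0 < h\<close> by (simp add: k_def b_def a_def power2_eq_square)
  ultimately have "(a powr p) powr (1 / p) \<le> (\<integral>z. cost z \<partial>\<pi>) powr (1 / p)"
    using p by (intro powr_mono2) auto
  then show False
    using *(4) p \<open>0 < a\<close> by (simp add: powr_powr)
qed

lemma d_star_nonneg: "\<rho> \<in> density_ops \<Longrightarrow> \<sigma> \<in> density_ops \<Longrightarrow> 0 \<le> d_star d p \<rho> \<sigma>"
  using d_star_lower[of \<rho> \<sigma>] c by (meson hs_norm_nonneg less_imp_le mult_nonneg_nonneg order_trans)

lemma d_star_sym_le:
  assumes "\<rho> \<in> density_ops" "\<sigma> \<in> density_ops"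
  shows "d_star d p \<sigma> \<rho> \<le> d_star d p \<rho> \<sigma>"
proof (rule dense_ge)
  fix r assume "d_star d p \<rho> \<sigma> < r"
  then obtain \<mu> \<nu> \<pi> where *: "\<mu> \<in> pure_decomps \<rho>" "\<nu> \<in> pure_decomps \<sigma>"
    "\<pi> \<in> couplings pure_states \<mu> \<nu>" "(\<integral>z. cost z \<partial>\<pi>) powr (1 / p) < r"
    using d_star_less_cost[OF assms] by blast
  have "cost (snd z, fst z) = cost z" for z
    by (simp add: cost_def d_sym)
  moreover have "closed (pure_states :: ('a \<Rightarrow>\<^sub>L 'a) set)"
    by (rule compact_imp_closed[OF compact_pure_states])
  ultimately have "d_star d p \<sigma> \<rho> \<le> (\<integral>z. cost z \<partial>\<pi>) powr (1 / p)"
    using d_star_le_cost[OF *(2,1) couplings_swap(1)[OF *(3)]]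
      couplings_swap(2)[OF *(3) _ continuous_on_cost] by simp
  then show "d_star d p \<sigma> \<rho> \<le> r"
    using *(4) by linarith
qed

lemma d_star_sym:
  "\<rho> \<in> density_ops \<Longrightarrow> \<sigma> \<in> density_ops \<Longrightarrow> d_star d p \<sigma> \<rho> = d_star d p \<rho> \<sigma>"
  by (intro antisym d_star_sym_le)

subsection \<open>Chains\<close>

definition chain :: "('a \<Rightarrow>\<^sub>L 'a) \<Rightarrow> ('a \<Rightarrow>\<^sub>L 'a) \<Rightarrow> nat \<Rightarrow> (nat \<Rightarrow> 'a \<Rightarrow>\<^sub>L 'a) \<Rightarrow> bool"
  where "chain \<rho> \<sigma> N \<gamma> \<longleftrightarrow>
    1 \<le> N \<and> \<gamma> 1 = \<rho> \<and> \<gamma> (N + 1) = \<sigma> \<and> (\<forall>n\<in>{1..N + 1}. \<gamma> n \<in> density_ops)"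

definition len :: "nat \<Rightarrow> (nat \<Rightarrow> 'a \<Rightarrow>\<^sub>L 'a) \<Rightarrow> real"
  where "len N \<gamma> = (\<Sum>n=1..N. d_star d p (\<gamma> n) (\<gamma> (n + 1)))"

abbreviation D :: "('a \<Rightarrow>\<^sub>L 'a) \<Rightarrow> ('a \<Rightarrow>\<^sub>L 'a) \<Rightarrow> real"
  where "D \<equiv> folded_dist d p"

lemma D_eq:
  "\<rho> \<in> density_ops \<Longrightarrow> \<sigma> \<in> density_ops \<Longrightarrow> D \<rho> \<sigma> = Inf {len N \<gamma> | N \<gamma>. chain \<rho> \<sigma> N \<gamma>}"
  by (simp add: folded_dist_def len_def chain_def)

lemma chain_single:
  "\<rho> \<in> density_ops \<Longrightarrow> \<sigma> \<in> density_ops \<Longrightarrow> chain \<rho> \<sigma> 1 (\<lambda>n. if n = 1 then \<rho> else \<sigma>)"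
  by (auto simp: chain_def)

lemma len_nonneg: "chain \<rho> \<sigma> N \<gamma> \<Longrightarrow> 0 \<le> len N \<gamma>"
  unfolding len_def chain_def by (intro sum_nonneg d_star_nonneg) auto

lemma D_le_len:
  assumes "\<rho> \<in> density_ops" "\<sigma> \<in> density_ops" "chain \<rho> \<sigma> N \<gamma>"
  shows "D \<rho> \<sigma> \<le> len N \<gamma>"
  unfolding D_eq[OF assms(1,2)]
  by (rule cInf_lower) (use assms len_nonneg in \<open>auto intro!: bdd_belowI[where m = 0]\<close>)

lemma D_le_d_star:
  "\<rho> \<in> density_ops \<Longrightarrow> \<sigma> \<in> density_ops \<Longrightarrow> D \<rho> \<sigma> \<le> d_star d p \<rho> \<sigma>"
  using D_le_len[OF _ _ chain_single] by (simp add: len_def)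

lemma D_less_len:
  assumes "\<rho> \<in> density_ops" "\<sigma> \<in> density_ops" "D \<rho> \<sigma> < r"
  obtains N \<gamma> where "chain \<rho> \<sigma> N \<gamma>" "len N \<gamma> < r"
proof -
  have "{len N \<gamma> | N \<gamma>. chain \<rho> \<sigma> N \<gamma>} \<noteq> {}"
    using chain_single[OF assms(1,2)] by blast
  from cInf_lessD[OF this assms(3)[unfolded D_eq[OF assms(1,2)]]] show thesis
    using that by blast
qed

lemma D_greatest:
  assumes "\<rho> \<in> density_ops" "\<sigma> \<in> density_ops" "\<And>N \<gamma>. chain \<rho> \<sigma> N \<gamma> \<Longrightarrow> x \<le> len N \<gamma>"
  shows "x \<le> D \<rho> \<sigma>"
proof (rule ccontr)
  assume "\<not> x \<le> D \<rho> \<sigma>"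
  then have "D \<rho> \<sigma> < x"
    by simp
  from D_less_len[OF assms(1,2) this] obtain N \<gamma> where "chain \<rho> \<sigma> N \<gamma>" "len N \<gamma> < x" .
  then show False
    using assms(3)[of N \<gamma>] by simp
qed

text \<open>The triangle inequality of \<open>hs_norm\<close> lets \<open>d_star_lower\<close> add
  up along a chain, by induction over its initial pieces.\<close>

lemma D_lower:
  assumes "\<rho> \<in> density_ops" "\<sigma> \<in> density_ops"
  shows "c * hs_norm (\<rho> - \<sigma>) \<le> D \<rho> \<sigma>"
proof (rule D_greatest[OF assms])
  fix N \<gamma> assume ch: "chain \<rho> \<sigma> N \<gamma>"
  have "c * hs_norm (\<gamma> 1 - \<gamma> (M + 1)) \<le> len M \<gamma>" if "M \<le> N" for M
    using that
  proof (induction M)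
    case 0
    show ?case
      by (simp add: len_def hs_norm_def L2_set_def)
  next
    case (Suc M)
    have "hs_norm (\<gamma> 1 - \<gamma> (Suc M + 1)) \<le> hs_norm (\<gamma> 1 - \<gamma> (M + 1)) + hs_norm (\<gamma> (M + 1) - \<gamma> (Suc M + 1))"
      using hs_norm_triangle[of "\<gamma> 1 - \<gamma> (M + 1)" "\<gamma> (M + 1) - \<gamma> (Suc M + 1)"] by simp
    then have "c * hs_norm (\<gamma> 1 - \<gamma> (Suc M + 1))
        \<le> c * hs_norm (\<gamma> 1 - \<gamma> (M + 1)) + c * hs_norm (\<gamma> (M + 1) - \<gamma> (Suc M + 1))"
      using c by (simp flip: distrib_left)
    also have "\<dots> \<le> len M \<gamma> + d_star d p (\<gamma> (M + 1)) (\<gamma> (Suc M + 1))"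
      using Suc ch by (intro add_mono d_star_lower) (auto simp: chain_def)
    finally show ?case
      by (simp add: len_def)
  qed
  from this[of N] show "c * hs_norm (\<rho> - \<sigma>) \<le> len N \<gamma>"
    using ch by (simp add: chain_def)
qed

section \<open>Metric axioms for \<open>D\<close>\<close>

lemma D_nonneg: "0 \<le> D \<rho> \<sigma>"
proof (cases "\<rho> \<in> density_ops \<and> \<sigma> \<in> density_ops")
  case True
  then show ?thesis
    using len_nonneg by (intro D_greatest) auto
qed (auto simp: folded_dist_def)

lemma D_self:
  assumes "\<rho> \<in> density_ops"
  shows "D \<rho> \<rho> = 0"
  using D_le_d_star[OF assms assms] d_star_le_plan[OF plans_diag[OF assms]] D_nonneg[of \<rho> \<rho>] p
  by simp

lemma D_sym_le:
  assumes "\<rho> \<in> density_ops" "\<sigma> \<in> density_ops"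
  shows "D \<sigma> \<rho> \<le> D \<rho> \<sigma>"
proof (rule D_greatest[OF assms])
  fix N \<gamma> assume ch: "chain \<rho> \<sigma> N \<gamma>"
  \<comment> \<open>The nodes run from 1 to N + 1, so reversal sends n to N + 2 - n; the links run
    from 1 to N and are reversed by N + 1 - n.\<close>
  define \<gamma>' where "\<gamma>' n = \<gamma> (N + 2 - n)" for n
  have "\<gamma> n \<in> density_ops" if "1 \<le> n" "n \<le> N + 1" for n
    using ch that by (simp add: chain_def)
  then have "chain \<sigma> \<rho> N \<gamma>'"
    using ch by (auto simp: chain_def \<gamma>'_def)
  then have "D \<sigma> \<rho> \<le> len N \<gamma>'"
    by (intro D_le_len assms)
  also have "len N \<gamma>' = (\<Sum>n=1..N. d_star d p (\<gamma>' (N + 1 - n)) (\<gamma>' (N + 1 - n + 1)))"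
    unfolding len_def by (subst sum.atLeastAtMost_rev) simp
  also have "\<dots> = len N \<gamma>"
    unfolding len_def
  proof (intro sum.cong refl)
    fix n assume n: "n \<in> {1..N}"
    then have "N + 2 - (N + 1 - n) = n + 1" "N + 2 - (N + 1 - n + 1) = n"
      by auto
    then show "d_star d p (\<gamma>' (N + 1 - n)) (\<gamma>' (N + 1 - n + 1)) = d_star d p (\<gamma> n) (\<gamma> (n + 1))"
      unfolding \<gamma>'_def using ch n by (auto intro!: d_star_sym simp: chain_def)
  qed
  finally show "D \<sigma> \<rho> \<le> len N \<gamma>" .
qed

lemma D_sym: "D \<sigma> \<rho> = D \<rho> \<sigma>"
proof (cases "\<rho> \<in> density_ops \<and> \<sigma> \<in> density_ops")
  case True
  then show ?thesis
    by (intro antisym D_sym_le) auto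
qed (auto simp: folded_dist_def)

lemma D_triangle:
  assumes "\<rho> \<in> density_ops" "\<sigma> \<in> density_ops" "\<tau> \<in> density_ops"
  shows "D \<rho> \<tau> \<le> D \<rho> \<sigma> + D \<sigma> \<tau>"
proof -
  have cat: "D \<rho> \<tau> \<le> len N \<gamma> + len M \<delta>" if \<gamma>: "chain \<rho> \<sigma> N \<gamma>" and \<delta>: "chain \<sigma> \<tau> M \<delta>" for N M \<gamma> \<delta>
  proof -
    \<comment> \<open>The chains agree at the joint: \<open>\<kappa> (N + 1)\<close> is
      \<open>\<delta> 1\<close>, which is \<sigma>, as is \<open>\<gamma> (N + 1)\<close>.\<close>
    define \<kappa> where "\<kappa> n = (if n \<le> N then \<gamma> n else \<delta> (n - N))" for n
    have "\<delta> n \<in> density_ops" if "1 \<le> n" "n \<le> M + 1" for n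
      using \<delta> that by (simp add: chain_def)
    then have "chain \<rho> \<tau> (N + M) \<kappa>"
      using \<gamma> \<delta> by (auto simp: chain_def \<kappa>_def)
    then have "D \<rho> \<tau> \<le> len (N + M) \<kappa>"
      by (intro D_le_len assms)
    also have "\<dots> = (\<Sum>n=1..N. d_star d p (\<kappa> n) (\<kappa> (n + 1)))
        + (\<Sum>n=N+1..N+M. d_star d p (\<kappa> n) (\<kappa> (n + 1)))"
      unfolding len_def by (rule sum.ub_add_nat) simp
    also have "(\<Sum>n=N+1..N+M. d_star d p (\<kappa> n) (\<kappa> (n + 1)))
        = (\<Sum>n=1..M. d_star d p (\<kappa> (n + N)) (\<kappa> (n + N + 1)))"
      using sum.shift_bounds_cl_nat_ivl[of "\<lambda>n. d_star d p (\<kappa> n) (\<kappa> (n + 1))" 1 N M]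
      by (simp add: add.commute)
    also have "\<dots> = len M \<delta>"
      unfolding len_def by (intro sum.cong refl) (auto simp: \<kappa>_def)
    also have "(\<Sum>n=1..N. d_star d p (\<kappa> n) (\<kappa> (n + 1))) = len N \<gamma>"
      unfolding len_def
    proof (intro sum.cong refl)
      fix n assume n: "n \<in> {1..N}"
      then have "\<kappa> (n + 1) = \<gamma> (n + 1)"
        using \<gamma> \<delta> by (cases "n = N") (auto simp: \<kappa>_def chain_def)
      then show "d_star d p (\<kappa> n) (\<kappa> (n + 1)) = d_star d p (\<gamma> n) (\<gamma> (n + 1))"
        using n by (simp add: \<kappa>_def)
    qed
    finally show ?thesis
      by simp
  qed
  \<comment> \<open>The two infima are taken in turn, each time with the other term moved to the
    left side.\<close>
  have "D \<rho> \<tau> - len M \<delta> \<le> D \<rho> \<sigma>" if "chain \<sigma> \<tau> M \<delta>" for M \<delta>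
    using cat[OF _ that] by (intro D_greatest assms) (auto simp: algebra_simps)
  then have "D \<rho> \<tau> - D \<rho> \<sigma> \<le> D \<sigma> \<tau>"
    by (intro D_greatest assms) (auto simp: algebra_simps)
  then show ?thesis
    by simp
qed

section \<open>Upper bounds, and the topology of the folded distance\<close>

lemma D_le_plan: "((\<rho>, \<sigma>), x) \<in> plans \<Longrightarrow> D \<rho> \<sigma> \<le> x powr (1 / p)"
  using D_le_d_star d_star_le_plan plans_density by (meson order_trans)

lemma D_le_d:
  assumes "P \<in> pure_states" "Q \<in> pure_states"
  shows "D P Q \<le> d P Q"
proof -
  have "((P, Q), cost (P, Q)) \<in> plans"
    unfolding plans_def using assms by (intro hull_inc) auto
  then have "D P Q \<le> (d P Q powr p) powr (1 / p)"
    by (intro D_le_plan) (simp add: cost_def)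
  then show ?thesis
    using p d_nonneg[OF assms] by (simp add: powr_powr)
qed

text \<open>The path from \<rho> to \<sigma> goes through their common mixture; each half is shorter
  than e / 2 because only the mass \<epsilon> has to move.\<close>

lemma D_small:
  assumes \<rho>: "\<rho> \<in> density_ops" and e: "0 < e"
  obtains \<delta> where "0 < \<delta>" "\<And>\<sigma>. \<sigma> \<in> density_ops \<Longrightarrow> norm (\<rho> - \<sigma>) < \<delta> \<Longrightarrow> D \<rho> \<sigma> < e"
proof -
  obtain C where C: "0 \<le> C" "\<And>z. z \<in> pure_states \<times> pure_states \<Longrightarrow> cost z \<le> C"
    using cost_bounded by metis
  define n where "n = real (card (onb :: 'a set))"
  have n: "0 < n"
    using card_onb_pos[where 'a = 'a] by (simp add: n_def)
  \<comment> \<open>Chosen so that \<epsilon> \<le> n * \<delta> implies \<epsilon> * C < (e / 2)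
    powr p; dividing by C + 1 allows C = 0.\<close>
  define \<delta> where "\<delta> = (e / 2) powr p / (n * (C + 1))"
  have "0 < \<delta>"
    using e n C(1) by (simp add: \<delta>_def)
  moreover have "D \<rho> \<sigma> < e" if \<sigma>: "\<sigma> \<in> density_ops" and close: "norm (\<rho> - \<sigma>) < \<delta>" for \<sigma>
  proof -
    obtain \<epsilon> \<eta> \<theta> where *: "0 \<le> \<epsilon>" "\<epsilon> \<le> 1" "\<epsilon> \<le> n * norm (\<rho> - \<sigma>)"
      "\<eta> \<in> density_ops" "\<theta> \<in> density_ops"
      "(1 - \<epsilon>) *\<^sub>R \<rho> + \<epsilon> *\<^sub>R \<eta> = (1 - \<epsilon>) *\<^sub>R \<sigma> + \<epsilon> *\<^sub>R \<theta>"
      using density_ops_common_mixture[OF \<rho> \<sigma>] unfolding n_def by blast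
    define \<tau> where "\<tau> = (1 - \<epsilon>) *\<^sub>R \<rho> + \<epsilon> *\<^sub>R \<eta>"
    have \<tau>: "\<tau> \<in> density_ops"
      unfolding \<tau>_def using \<rho> * by (intro convexD[OF convex_density_ops]) auto
    have "\<epsilon> \<le> n * \<delta>"
      using *(3) close n by (meson less_imp_le mult_left_mono order_trans)
    then have "\<epsilon> * C \<le> (n * \<delta>) * C"
      using C(1) by (rule mult_right_mono)
    also have "\<dots> < (n * \<delta>) * (C + 1)"
      using n \<open>0 < \<delta>\<close> by (simp add: zero_less_mult_iff)
    also have "\<dots> = (e / 2) powr p"
      using n C(1) by (simp add: \<delta>_def)
    finally have small: "\<epsilon> * C < (e / 2) powr p" .
    have "D \<alpha> ((1 - \<epsilon>) *\<^sub>R \<alpha> + \<epsilon> *\<^sub>R \<beta>) < e / 2" if \<alpha>\<beta>: "\<alpha> \<in> density_ops" "\<beta> \<in> density_ops" for \<alpha> \<beta>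
    proof -
      obtain x where x: "0 \<le> x" "x \<le> \<epsilon> * C" "((\<alpha>, (1 - \<epsilon>) *\<^sub>R \<alpha> + \<epsilon> *\<^sub>R \<beta>), x) \<in> plans"
        using plans_mixture[OF \<alpha>\<beta> *(1,2) C(2)] .
      have "D \<alpha> ((1 - \<epsilon>) *\<^sub>R \<alpha> + \<epsilon> *\<^sub>R \<beta>) \<le> x powr (1 / p)"
        using x(3) by (rule D_le_plan)
      also have "\<dots> < ((e / 2) powr p) powr (1 / p)"
        using x small p by (intro powr_less_mono2) auto
      also have "\<dots> = e / 2"
        using e p by (simp add: powr_powr)
      finally show ?thesis .
    qed
    from this[OF \<rho> *(4)] this[OF \<sigma> *(5)] have "D \<rho> \<tau> < e / 2" "D \<sigma> \<tau> < e / 2"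
      unfolding *(6)[symmetric] \<tau>_def[symmetric] by auto
    then show ?thesis
      using D_triangle[OF \<rho> \<tau> \<sigma>] D_sym[of \<tau> \<sigma>] by simp
  qed
  ultimately show thesis
    using that by blast
qed

lemma Metric_space_D: "Metric_space density_ops D"
proof
  fix \<rho> \<sigma> :: "'a \<Rightarrow>\<^sub>L 'a"
  show "0 \<le> D \<rho> \<sigma>"
    by (rule D_nonneg)
  show "D \<rho> \<sigma> = D \<sigma> \<rho>"
    by (rule D_sym)
  assume *: "\<rho> \<in> density_ops" "\<sigma> \<in> density_ops"
  show "D \<rho> \<sigma> = 0 \<longleftrightarrow> \<rho> = \<sigma>"
  proof
    assume "D \<rho> \<sigma> = 0"
    then have "hs_norm (\<rho> - \<sigma>) \<le> 0"
      using D_lower[OF *] c by (simp add: mult_le_0_iff)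
    then show "\<rho> = \<sigma>"
      using norm_density_diff_le[OF *] by (meson eq_iff_diff_eq_0 norm_le_zero_iff order_trans)
  qed (use * D_self in auto)
  fix \<tau> :: "'a \<Rightarrow>\<^sub>L 'a" assume "\<tau> \<in> density_ops"
  with * show "D \<rho> \<tau> \<le> D \<rho> \<sigma> + D \<sigma> \<tau>"
    by (intro D_triangle)
qed

text \<open>\<open>D_small\<close> puts a norm ball inside each ball of \<open>D\<close>;
  \<open>D_lower\<close> puts the ball of \<open>D\<close> of radius c * e inside the norm ball of
  radius e.\<close>

lemma mtopology_D: "Metric_space.mtopology density_ops D = top_of_set density_ops"
proof -
  interpret M: Metric_space density_ops D
    by (rule Metric_space_D)
  have "openin M.mtopology U \<longleftrightarrow> openin (top_of_set density_ops) U" for U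
  proof -
    have "(\<exists>r>0. M.mball \<rho> r \<subseteq> U) \<longleftrightarrow> (\<exists>e>0. \<forall>\<sigma>\<in>density_ops. dist \<sigma> \<rho> < e \<longrightarrow> \<sigma> \<in> U)"
      if \<rho>: "\<rho> \<in> density_ops" for \<rho>
    proof
      assume "\<exists>r>0. M.mball \<rho> r \<subseteq> U"
      then obtain r where r: "0 < r" "M.mball \<rho> r \<subseteq> U"
        by blast
      obtain \<delta> where "0 < \<delta>" "\<And>\<sigma>. \<sigma> \<in> density_ops \<Longrightarrow> norm (\<rho> - \<sigma>) < \<delta> \<Longrightarrow> D \<rho> \<sigma> < r"
        using D_small[OF \<rho> r(1)] by metis
      then show "\<exists>e>0. \<forall>\<sigma>\<in>density_ops. dist \<sigma> \<rho> < e \<longrightarrow> \<sigma> \<in> U"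
        using r(2) \<rho> by (intro exI[of _ \<delta>]) (auto simp: subset_iff dist_norm norm_minus_commute)
    next
      assume "\<exists>e>0. \<forall>\<sigma>\<in>density_ops. dist \<sigma> \<rho> < e \<longrightarrow> \<sigma> \<in> U"
      then obtain e where e: "0 < e" "\<And>\<sigma>. \<sigma> \<in> density_ops \<Longrightarrow> dist \<sigma> \<rho> < e \<Longrightarrow> \<sigma> \<in> U"
        by blast
      have "\<sigma> \<in> U" if "\<sigma> \<in> density_ops" "D \<rho> \<sigma> < c * e" for \<sigma>
      proof -
        have "c * hs_norm (\<rho> - \<sigma>) < c * e"
          using D_lower[OF \<rho> that(1)] that(2) by simp
        then have "norm (\<rho> - \<sigma>) < e"
          using norm_density_diff_le[OF \<rho> that(1)] c by simp
        then show ?thesis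
          using e(2)[OF that(1)] by (simp add: dist_norm norm_minus_commute)
      qed
      then show "\<exists>r>0. M.mball \<rho> r \<subseteq> U"
        using c e(1) by (intro exI[of _ "c * e"]) auto
    qed
    then show ?thesis
      unfolding M.openin_mtopology openin_euclidean_subtopology_iff by blast
  qed
  then show ?thesis
    by (simp add: topology_eq)
qed

subsection \<open>Geodesics\<close>

text \<open>Parametrized by length, so that lengths add under concatenation. The additive error e
  leaves room for the jumps with which the curves of plans are attached to prescribed ends.\<close>

definition near_curve :: "('a \<Rightarrow>\<^sub>L 'a) \<Rightarrow> ('a \<Rightarrow>\<^sub>L 'a) \<Rightarrow> real \<Rightarrow> real \<Rightarrow> bool"
  where "near_curve \<rho> \<sigma> l e \<longleftrightarrow> (\<exists>f. f 0 = \<rho> \<and> f l = \<sigma> \<and> f ` {0..l} \<subseteq> density_ops \<and>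
    (\<forall>s t. 0 \<le> s \<longrightarrow> s \<le> t \<longrightarrow> t \<le> l \<longrightarrow> D (f s) (f t) \<le> t - s + e))"

lemma near_curve_concat:
  assumes "near_curve \<rho> \<sigma> a e" "near_curve \<sigma> \<tau> b e'" "0 \<le> a" "0 \<le> b" "0 \<le> e" "0 \<le> e'"
  shows "near_curve \<rho> \<tau> (a + b) (e + e')"
proof -
  obtain f where f: "f 0 = \<rho>" "f a = \<sigma>" "f ` {0..a} \<subseteq> density_ops"
    "\<And>s t. 0 \<le> s \<Longrightarrow> s \<le> t \<Longrightarrow> t \<le> a \<Longrightarrow> D (f s) (f t) \<le> t - s + e"
    using assms(1) by (auto simp: near_curve_def)
  obtain g where g: "g 0 = \<sigma>" "g b = \<tau>" "g ` {0..b} \<subseteq> density_ops"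
    "\<And>s t. 0 \<le> s \<Longrightarrow> s \<le> t \<Longrightarrow> t \<le> b \<Longrightarrow> D (g s) (g t) \<le> t - s + e'"
    using assms(2) by (auto simp: near_curve_def)
  have fS: "f s \<in> density_ops" if "0 \<le> s" "s \<le> a" for s
    using f(3) that by auto
  have gS: "g s \<in> density_ops" if "0 \<le> s" "s \<le> b" for s
    using g(3) that by auto
  define h where "h s = (if s \<le> a then f s else g (s - a))" for s
  have "D (h s) (h t) \<le> t - s + (e + e')" if st: "0 \<le> s" "s \<le> t" "t \<le> a + b" for s t
  proof -
    consider "t \<le> a" | "a < s" | "s \<le> a" "a < t"
      by linarith
    then show ?thesis
    proof cases
      case 1
      then show ?thesis
        using f(4)[of s t] st assms by (simp add: h_def)
    next
      case 2
      then show ?thesis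
        using g(4)[of "s - a" "t - a"] st assms by (simp add: h_def)
    next
      \<comment> \<open>Across the joint, the triangle inequality through \<sigma> spends one error
        from each side.\<close>
      case 3
      have "D (f s) (g (t - a)) \<le> D (f s) \<sigma> + D \<sigma> (g (t - a))"
        using 3 st assms fS[of a] f(2) by (intro D_triangle fS gS) auto
      then show ?thesis
        using 3 f(4)[of s a] g(4)[of 0 "t - a"] st assms by (simp add: h_def f(2) g(1))
    qed
  qed
  moreover have "h 0 = \<rho>" "h (a + b) = \<tau>" "h ` {0..a + b} \<subseteq> density_ops"
    using f g fS gS assms by (auto simp: h_def)
  ultimately show ?thesis
    unfolding near_curve_def by blast
qed

text \<open>The triple is the barycentre of the map sending z to (z, cost z), hence lies in the
  closed hull of its values.\<close>

lemma coupling_cost_in_closure_plans: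
  assumes "\<pi> \<in> couplings pure_states \<mu> \<nu>" "\<mu> \<in> pure_decomps \<rho>" "\<nu> \<in> pure_decomps \<sigma>"
  shows "((\<rho>, \<sigma>), \<integral>z. cost z \<partial>\<pi>) \<in> closure plans"
proof -
  let ?E = "pure_states \<times> pure_states :: (('a \<Rightarrow>\<^sub>L 'a) \<times> ('a \<Rightarrow>\<^sub>L 'a)) set"
  have r: "\<pi> \<in> radon_prob ?E"
    using assms(1) by (auto simp: couplings_def)
  have E: "compact ?E"
    by (intro compact_Times compact_pure_states)
  have cont: "continuous_on ?E (\<lambda>z. (z, cost z))"
    by (intro continuous_intros continuous_on_cost)
  have int: "integrable \<pi> (\<lambda>z. (z, cost z))"
    by (rule integrable_radon[OF r cont E])
  define I where "I = (\<integral>z. (z, cost z) \<partial>\<pi>)"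
  have I: "I \<in> closure plans"
    unfolding I_def plans_def
    by (intro integral_in_closure_convex_hull radon_probD(1)[OF r] measurable_radon[OF r] cont
        compact_continuous_image E) (simp_all add: radon_probD(3)[OF r])
  have "(\<integral>z. fst (fst (z, cost z)) \<partial>\<pi>) = fst (fst I)" "(\<integral>z. snd (fst (z, cost z)) \<partial>\<pi>) = snd (fst I)"
    "(\<integral>z. snd (z, cost z) \<partial>\<pi>) = snd I"
    unfolding I_def
    by (intro integral_bounded_linear[OF _ int] bounded_linear_intros)+
  then have "I = ((\<rho>, \<sigma>), \<integral>z. cost z \<partial>\<pi>)"
    using coupling_marginal_integrals[OF assms] by (simp add: prod_eq_iff)
  then show ?thesis
    using I by simp
qed

end

text \<open>After the power 1 / p, the cost (t - s) powr p * x says that the curve has constant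
  speed. The condition concerns finitely supported plans only, where each of the two geodesic cases
  can be checked by hand.\<close>

locale geodesic_ground_distance = ground_distance +
  assumes plan_curve: "\<And>\<rho> \<sigma> x. ((\<rho>, \<sigma>), x) \<in> plans \<Longrightarrow> \<exists>f. f 0 = \<rho> \<and> f 1 = \<sigma> \<and>
    (\<forall>s t. 0 \<le> s \<longrightarrow> s \<le> t \<longrightarrow> t \<le> 1 \<longrightarrow> ((f s, f t), (t - s) powr p * x) \<in> plans)"
begin

text \<open>A nearly optimal coupling is approximated by a plan with ends close to \<rho> and
  \<sigma>. Resetting the two ends of its curve costs e / 2 each. The slack e in the length makes r
  positive and r powr p strictly larger than the cost of the coupling.\<close>

lemma near_curve_d_star:
  assumes \<rho>: "\<rho> \<in> density_ops" and \<sigma>: "\<sigma> \<in> density_ops" and e: "0 < e"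
  shows "near_curve \<rho> \<sigma> (d_star d p \<rho> \<sigma> + e) e"
proof -
  define r where "r = d_star d p \<rho> \<sigma> + e"
  have r: "0 < r" "d_star d p \<rho> \<sigma> < r"
    using d_star_nonneg[OF \<rho> \<sigma>] e by (auto simp: r_def)
  obtain \<mu> \<nu> \<pi> where *: "\<mu> \<in> pure_decomps \<rho>" "\<nu> \<in> pure_decomps \<sigma>"
    "\<pi> \<in> couplings pure_states \<mu> \<nu>" "(\<integral>z. cost z \<partial>\<pi>) powr (1 / p) < r"
    using d_star_less_cost[OF \<rho> \<sigma> r(2)] .
  define X where "X = (\<integral>z. cost z \<partial>\<pi>)"
  have "0 \<le> X"
    unfolding X_def using cost_nonneg by (intro integral_nonneg_AE) auto
  have "(X powr (1 / p)) powr p < r powr p"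
    using *(4) p by (intro powr_less_mono2) (auto simp: X_def)
  then have X: "X < r powr p"
    using p \<open>0 \<le> X\<close> by (simp add: powr_powr)
  obtain \<delta> where \<delta>: "0 < \<delta>" "\<And>\<tau>. \<tau> \<in> density_ops \<Longrightarrow> norm (\<rho> - \<tau>) < \<delta> \<Longrightarrow> D \<rho> \<tau> < e / 2"
    using D_small[OF \<rho> half_gt_zero[OF e]] by metis
  obtain \<delta>' where \<delta>': "0 < \<delta>'" "\<And>\<tau>. \<tau> \<in> density_ops \<Longrightarrow> norm (\<sigma> - \<tau>) < \<delta>' \<Longrightarrow> D \<sigma> \<tau> < e / 2"
    using D_small[OF \<sigma> half_gt_zero[OF e]] by metis
  \<comment> \<open>Small enough for both ends to move by less than e / 2 in \<open>D\<close> and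
    for the cost to stay below r powr p.\<close>
  define \<epsilon> where "\<epsilon> = min (min \<delta> \<delta>') (r powr p - X)"
  have "0 < \<epsilon>"
    using \<delta> \<delta>' X by (simp add: \<epsilon>_def)
  then obtain y where y: "y \<in> plans" "dist y ((\<rho>, \<sigma>), X) < \<epsilon>"
    using coupling_cost_in_closure_plans[OF *(3,1,2)] unfolding X_def closure_approachable by blast
  obtain \<rho>' \<sigma>' x where yeq: "y = ((\<rho>', \<sigma>'), x)"
    by (metis surj_pair)
  have S': "\<rho>' \<in> density_ops" "\<sigma>' \<in> density_ops" "0 \<le> x"
    using plans_density y(1) yeq by blast+
  have "dist \<rho>' \<rho> < \<epsilon>" "dist \<sigma>' \<sigma> < \<epsilon>" "dist x X < \<epsilon>"
    using y(2) dist_fst_le[of y "((\<rho>, \<sigma>), X)"] dist_snd_le[of y "((\<rho>, \<sigma>), X)"]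
      dist_fst_le[of "(\<rho>', \<sigma>')" "(\<rho>, \<sigma>)"] dist_snd_le[of "(\<rho>', \<sigma>')" "(\<rho>, \<sigma>)"]
    by (auto simp: yeq)
  then have close: "D \<rho> \<rho>' < e / 2" "D \<sigma> \<sigma>' < e / 2" "x < r powr p"
    using \<delta>(2)[OF S'(1)] \<delta>'(2)[OF S'(2)] by (auto simp: \<epsilon>_def dist_norm norm_minus_commute)
  obtain f where f: "f 0 = \<rho>'" "f 1 = \<sigma>'"
    "\<And>s t. 0 \<le> s \<Longrightarrow> s \<le> t \<Longrightarrow> t \<le> 1 \<Longrightarrow> ((f s, f t), (t - s) powr p * x) \<in> plans"
    using plan_curve[OF y(1)[unfolded yeq]] by blast
  have fS: "f s \<in> density_ops" if "0 \<le> s" "s \<le> 1" for s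
    using plans_density[OF f(3)[of s s]] that by blast
  have fD: "D (f (s / r)) (f (t / r)) \<le> t - s" if "0 \<le> s" "s \<le> t" "t \<le> r" for s t
  proof -
    have st: "0 \<le> s / r" "s / r \<le> t / r" "t / r \<le> 1"
      using that r by (auto simp: field_simps)
    have "D (f (s / r)) (f (t / r)) \<le> ((t / r - s / r) powr p * x) powr (1 / p)"
      by (rule D_le_plan[OF f(3)[OF st]])
    also have "\<dots> \<le> ((t / r - s / r) powr p * r powr p) powr (1 / p)"
      using close(3) S'(3) p by (intro powr_mono2 mult_left_mono) auto
    also have "\<dots> = (t / r - s / r) * r"
      using st r p by (simp add: powr_powr flip: powr_mult)
    also have "\<dots> = t - s"
      using r by (simp add: field_simps)
    finally show ?thesis .
  qed
  define g where "g s = (if s \<le> 0 then \<rho> else if r \<le> s then \<sigma> else f (s / r))" for s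
  have gS: "g s \<in> density_ops" if "0 \<le> s" "s \<le> r" for s
    using that \<rho> \<sigma> r fS[of "s / r"] by (auto simp: g_def field_simps)
  have gf: "D (g s) (f (s / r)) \<le> e / 2" if "0 \<le> s" "s \<le> r" for s
  proof -
    consider "s = 0" | "s = r" | "0 < s" "s < r"
      using \<open>0 \<le> s\<close> \<open>s \<le> r\<close> by linarith
    then show ?thesis
    proof cases
      case 3
      then show ?thesis
        using D_self[OF fS[of "s / r"]] r e by (simp add: g_def)
    qed (use close r f in \<open>auto simp: g_def\<close>)
  qed
  have "D (g s) (g t) \<le> t - s + e" if "0 \<le> s" "s \<le> t" "t \<le> r" for s t
  proof -
    have "0 \<le> s / r" "s / r \<le> 1" "0 \<le> t / r" "t / r \<le> 1"
      using that r by (auto simp: field_simps)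
    then have "D (g s) (g t) \<le> D (g s) (f (s / r)) + D (f (s / r)) (g t)"
      "D (f (s / r)) (g t) \<le> D (f (s / r)) (f (t / r)) + D (f (t / r)) (g t)"
      using that by (auto intro!: D_triangle gS fS)
    then show ?thesis
      using gf[of s] gf[of t] fD[OF that] that by (simp add: D_sym)
  qed
  moreover have "g 0 = \<rho>" "g r = \<sigma>"
    using r by (simp_all add: g_def)
  moreover have "g ` {0..r} \<subseteq> density_ops"
    using gS by auto
  ultimately show ?thesis
    unfolding near_curve_def r_def[symmetric] by blast
qed

lemma near_curve_chain:
  assumes e: "0 < e" and S: "\<And>n. 1 \<le> n \<Longrightarrow> n \<le> N + 1 \<Longrightarrow> \<gamma> n \<in> density_ops"
  shows "near_curve (\<gamma> 1) (\<gamma> (N + 1)) (len N \<gamma> + real N * e) (real N * e)"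
  using S
proof (induction N)
  case 0
  have "near_curve (\<gamma> 1) (\<gamma> 1) 0 0"
    unfolding near_curve_def using 0 D_self by (intro exI[of _ "\<lambda>_. \<gamma> 1"]) auto
  then show ?case
    by (simp add: len_def)
next
  case (Suc N)
  have S: "\<gamma> (N + 1) \<in> density_ops" "\<gamma> (Suc N + 1) \<in> density_ops"
    using Suc.prems by auto
  have "0 \<le> len N \<gamma>"
    unfolding len_def using Suc.prems by (intro sum_nonneg d_star_nonneg) auto
  then have "near_curve (\<gamma> 1) (\<gamma> (Suc N + 1))
      ((len N \<gamma> + real N * e) + (d_star d p (\<gamma> (N + 1)) (\<gamma> (Suc N + 1)) + e)) (real N * e + e)"
    using Suc.prems e d_star_nonneg[OF S]
    by (intro near_curve_concat[OF Suc.IH near_curve_d_star[OF S e]]) auto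
  moreover have "len (Suc N) \<gamma> = len N \<gamma> + d_star d p (\<gamma> (N + 1)) (\<gamma> (Suc N + 1))"
    by (simp add: len_def)
  ultimately show ?case
    by (simp add: algebra_simps)
qed

lemma near_geodesic:
  assumes \<rho>: "\<rho> \<in> density_ops" and \<sigma>: "\<sigma> \<in> density_ops" and e: "0 < e"
  obtains f where "f 0 = \<rho>" "f 1 = \<sigma>" "range f \<subseteq> density_ops"
    "\<And>s t. 0 \<le> s \<Longrightarrow> s \<le> t \<Longrightarrow> t \<le> 1 \<Longrightarrow> D (f s) (f t) \<le> (t - s) * D \<rho> \<sigma> + e"
proof -
  have "D \<rho> \<sigma> < D \<rho> \<sigma> + e / 3"
    using e by simp
  then obtain N \<gamma> where \<gamma>: "chain \<rho> \<sigma> N \<gamma>" "len N \<gamma> < D \<rho> \<sigma> + e / 3"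
    by (rule D_less_len[OF \<rho> \<sigma>])
  have N: "1 \<le> N" "\<gamma> 1 = \<rho>" "\<gamma> (N + 1) = \<sigma>" "\<And>n. 1 \<le> n \<Longrightarrow> n \<le> N + 1 \<Longrightarrow> \<gamma> n \<in> density_ops"
    using \<gamma>(1) by (auto simp: chain_def)
  \<comment> \<open>Over N links this gives error e / 3 and extra length e / 3; the remaining third
    of e is the excess of \<open>len N \<gamma>\<close> over
    \<open>D \<rho> \<sigma>\<close>.\<close>
  define \<epsilon> where "\<epsilon> = e / 3 / N"
  have \<epsilon>: "0 < \<epsilon>" "real N * \<epsilon> = e / 3"
    using e N(1) by (auto simp: \<epsilon>_def)
  define l where "l = len N \<gamma> + e / 3"
  have l: "0 < l" "l \<le> D \<rho> \<sigma> + 2 * e / 3"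
    using len_nonneg[OF \<gamma>(1)] e \<gamma>(2) by (auto simp: l_def)
  have "near_curve \<rho> \<sigma> l (e / 3)"
    using near_curve_chain[of \<epsilon> N \<gamma>, OF \<epsilon>(1) N(4)] unfolding N(2,3) \<epsilon>(2) l_def .
  then obtain f where f: "f 0 = \<rho>" "f l = \<sigma>" "f ` {0..l} \<subseteq> density_ops"
    "\<And>s t. 0 \<le> s \<Longrightarrow> s \<le> t \<Longrightarrow> t \<le> l \<Longrightarrow> D (f s) (f t) \<le> t - s + e / 3"
    unfolding near_curve_def by blast
  define g where "g s = (if 0 \<le> s \<and> s \<le> 1 then f (s * l) else \<rho>)" for s
  show thesis
  proof (rule that)
    show "g 0 = \<rho>" "g 1 = \<sigma>"
      using f by (auto simp: g_def)
    show "range g \<subseteq> density_ops"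
      using f(3) l \<rho> by (auto simp: g_def image_subset_iff mult_left_le_one_le)
    fix s t :: real assume st: "0 \<le> s" "s \<le> t" "t \<le> 1"
    have "D (f (s * l)) (f (t * l)) \<le> t * l - s * l + e / 3"
      using st l by (intro f(4)) (auto intro: mult_right_mono mult_left_le_one_le)
    also have "t * l - s * l = (t - s) * l"
      by (simp add: algebra_simps)
    also have "(t - s) * l \<le> (t - s) * (D \<rho> \<sigma> + 2 * e / 3)"
      using st l by (intro mult_left_mono) auto
    also have "\<dots> \<le> (t - s) * D \<rho> \<sigma> + 1 * (2 * e / 3)"
      unfolding distrib_left using st e by (intro add_left_mono mult_right_mono) auto
    finally show "D (g s) (g t) \<le> (t - s) * D \<rho> \<sigma> + e"
      using st by (simp add: g_def)
  qed
qed

text \<open>Joint continuity in the norm topology makes the constraints on approximate geodesics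
  closed under pointwise limits.\<close>

lemma continuous_on_D: "continuous_on (density_ops \<times> density_ops) (\<lambda>z. D (fst z) (snd z))"
  unfolding continuous_on_iff
proof (intro ballI allI impI)
  fix z :: "('a \<Rightarrow>\<^sub>L 'a) \<times> ('a \<Rightarrow>\<^sub>L 'a)" and e :: real
  assume "z \<in> density_ops \<times> density_ops" and e: "0 < e"
  then have S: "fst z \<in> density_ops" "snd z \<in> density_ops"
    by auto
  obtain \<delta> where \<delta>: "0 < \<delta>" "\<And>\<tau>. \<tau> \<in> density_ops \<Longrightarrow> norm (fst z - \<tau>) < \<delta> \<Longrightarrow> D (fst z) \<tau> < e / 2"
    using D_small[OF S(1) half_gt_zero[OF e]] by metis
  obtain \<delta>' where \<delta>': "0 < \<delta>'" "\<And>\<tau>. \<tau> \<in> density_ops \<Longrightarrow> norm (snd z - \<tau>) < \<delta>' \<Longrightarrow> D (snd z) \<tau> < e / 2"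
    using D_small[OF S(2) half_gt_zero[OF e]] by metis
  have "dist (D (fst w) (snd w)) (D (fst z) (snd z)) < e"
    if w: "w \<in> density_ops \<times> density_ops" "dist w z < min \<delta> \<delta>'" for w
  proof -
    have Sw: "fst w \<in> density_ops" "snd w \<in> density_ops"
      using w(1) by auto
    have "norm (fst z - fst w) < \<delta>" "norm (snd z - snd w) < \<delta>'"
      using w(2) dist_fst_le[of w z] dist_snd_le[of w z]
      by (auto simp: dist_norm norm_minus_commute)
    from \<delta>(2)[OF Sw(1) this(1)] \<delta>'(2)[OF Sw(2) this(2)] show ?thesis
      using D_triangle[OF Sw(1) S(1) Sw(2)] D_triangle[OF S(1) S(2) Sw(2)]
        D_triangle[OF S(1) Sw(1) S(2)] D_triangle[OF Sw(1) Sw(2) S(2)]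
        D_sym[of "fst w" "fst z"] D_sym[of "snd w" "snd z"]
      by (simp add: dist_real_def abs_less_iff)
  qed
  then show "\<exists>\<delta>>0. \<forall>w\<in>density_ops \<times> density_ops. dist w z < \<delta> \<longrightarrow>
      dist (D (fst w) (snd w)) (D (fst z) (snd z)) < e"
    using \<delta>(1) \<delta>'(1) by (intro exI[of _ "min \<delta> \<delta>'"]) auto
qed

text \<open>
  By Tychonoff's theorem the closed sets of \<open>1/(k+1)\<close>-approximate geodesics, which are nested and
  nonempty, have a common point.
\<close>

lemma geodesic_exists:
  assumes \<rho>: "\<rho> \<in> density_ops" and \<sigma>: "\<sigma> \<in> density_ops"
  obtains f :: "real \<Rightarrow> 'a \<Rightarrow>\<^sub>L 'a" where "f 0 = \<rho>" "f 1 = \<sigma>" "range f \<subseteq> density_ops"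
    "\<And>s t. 0 \<le> s \<Longrightarrow> s \<le> t \<Longrightarrow> t \<le> 1 \<Longrightarrow> D (f s) (f t) \<le> (t - s) * D \<rho> \<sigma>"
proof -
  \<comment> \<open>Curves are points of a product indexed by all real times, with pointwise
    convergence.\<close>
  define F :: "(real \<Rightarrow> 'a \<Rightarrow>\<^sub>L 'a) set" where "F = PiE UNIV (\<lambda>_. density_ops)"
  have "compactin (product_topology (\<lambda>_. euclidean) UNIV) F"
    unfolding F_def compactin_PiE by (simp add: compactin_euclidean_iff compact_density_ops)
  then have F: "compact F"
    by (simp add: euclidean_product_topology compactin_euclidean_iff)
  define Z where "Z r = {z \<in> density_ops \<times> density_ops. D (fst z) (snd z) \<le> r}" for r
  have Z: "closed (Z r)" for r
    unfolding Z_def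
    by (intro continuous_on_closed_Collect_le continuous_on_D continuous_on_const closed_Times
        closed_density_ops)
  define A where "A k = {f. f 0 = \<rho> \<and> f 1 = \<sigma> \<and>
    (\<forall>s t. 0 \<le> s \<longrightarrow> s \<le> t \<longrightarrow> t \<le> 1 \<longrightarrow> (f s, f t) \<in> Z ((t - s) * D \<rho> \<sigma> + 1 / real (Suc k)))}" for k
  have ev: "continuous_on UNIV (\<lambda>f :: real \<Rightarrow> 'a \<Rightarrow>\<^sub>L 'a. f s)" for s
    by (rule continuous_on_product_coordinates)
  have closed_A: "closed (A k)" for k
  proof -
    have "closed ((\<lambda>f :: real \<Rightarrow> 'a \<Rightarrow>\<^sub>L 'a. (f s, f t)) -` Z r)" for s t r
      by (intro closed_vimage Z continuous_on_Pair ev)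
    then show ?thesis
      unfolding A_def
      by (intro closed_Collect_conj closed_Collect_eq closed_Collect_all closed_Collect_imp
          open_Collect_const ev continuous_on_const) (simp add: vimage_def)
  qed
  have fip: "F \<inter> (\<Inter>k\<in>I. A k) \<noteq> {}" if "finite I" for I
  proof -
    \<comment> \<open>The sets \<open>A k\<close> decrease in k, so the largest index decides;
      inserting 0 covers empty I.\<close>
    define m where "m = Max (insert 0 I)"
    obtain f where f: "f 0 = \<rho>" "f 1 = \<sigma>" "range f \<subseteq> density_ops"
      "\<And>s t. 0 \<le> s \<Longrightarrow> s \<le> t \<Longrightarrow> t \<le> 1 \<Longrightarrow> D (f s) (f t) \<le> (t - s) * D \<rho> \<sigma> + 1 / real (Suc m)"
      by (rule near_geodesic[OF \<rho> \<sigma>, of "1 / real (Suc m)"]) auto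
    have "f \<in> A k" if "k \<in> I" for k
    proof -
      have "k \<le> m"
        using that \<open>finite I\<close> by (simp add: m_def)
      then have "1 / real (Suc m) \<le> 1 / real (Suc k)"
        by (simp add: field_simps)
      then have "D (f s) (f t) \<le> (t - s) * D \<rho> \<sigma> + 1 / real (Suc k)"
        if "0 \<le> s" "s \<le> t" "t \<le> 1" for s t
        using f(4)[OF that] by linarith
      then show ?thesis
        using f(1-3) by (auto simp: A_def Z_def)
    qed
    moreover have "f \<in> F"
      using f(3) by (auto simp: F_def)
    ultimately show ?thesis
      by blast
  qed
  have "F \<inter> (\<Inter>k. A k) \<noteq> {}"
    by (rule compact_imp_fip_image[OF F closed_A fip])
  then obtain f where f: "f \<in> F" "\<And>k. f \<in> A k"
    by blast
  show thesis
  proof (rule that)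
    show "f 0 = \<rho>" "f 1 = \<sigma>"
      using f(2)[of 0] by (auto simp: A_def)
    show "range f \<subseteq> density_ops"
      using f(1) by (auto simp: F_def)
    fix s t :: real assume st: "0 \<le> s" "s \<le> t" "t \<le> 1"
    have *: "D (f s) (f t) - (t - s) * D \<rho> \<sigma> \<le> 1 / real (Suc k)" for k
      using f(2)[of k] st by (auto simp: A_def Z_def algebra_simps)
    have "D (f s) (f t) - (t - s) * D \<rho> \<sigma> \<le> 0"
    proof (rule LIMSEQ_le_const)
      show "(\<lambda>k. 1 / real (Suc k)) \<longlonglongrightarrow> 0"
        using LIMSEQ_inverse_real_of_nat by (simp add: inverse_eq_divide)
    qed (use * in auto)
    then show "D (f s) (f t) \<le> (t - s) * D \<rho> \<sigma>"
      by simp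
  qed
qed

text \<open>The upper bounds on [0, s], [s, t] and [t, 1] add up to
  \<open>D \<rho> \<sigma>\<close>, which is at most the sum of the three distances; so each bound
  is an equality.\<close>

lemma geodesic_space_D: "geodesic_space density_ops D"
  unfolding geodesic_space_def
proof (intro conjI ballI Metric_space_D)
  fix \<rho> \<sigma> :: "'a \<Rightarrow>\<^sub>L 'a" assume *: "\<rho> \<in> density_ops" "\<sigma> \<in> density_ops"
  obtain f :: "real \<Rightarrow> 'a \<Rightarrow>\<^sub>L 'a" where f: "f 0 = \<rho>" "f 1 = \<sigma>" "range f \<subseteq> density_ops"
    and le: "\<And>s t. 0 \<le> s \<Longrightarrow> s \<le> t \<Longrightarrow> t \<le> 1 \<Longrightarrow> D (f s) (f t) \<le> (t - s) * D \<rho> \<sigma>"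
    by (rule geodesic_exists[OF *]) (rule that)
  have fS: "f s \<in> density_ops" for s
    using f(3) by auto
  have eq: "D (f s) (f t) = (t - s) * D \<rho> \<sigma>" if st: "0 \<le> s" "s \<le> t" "t \<le> 1" for s t
  proof (rule antisym[OF le[OF st]])
    have "D \<rho> \<sigma> \<le> D (f 0) (f s) + D (f s) (f 1)" "D (f s) (f 1) \<le> D (f s) (f t) + D (f t) (f 1)"
      using f(1,2) by (auto intro!: D_triangle fS *)
    moreover have "D (f 0) (f s) \<le> s * D \<rho> \<sigma>" "D (f t) (f 1) \<le> (1 - t) * D \<rho> \<sigma>"
      using le[of 0 s] le[of t 1] st by auto
    ultimately show "(t - s) * D \<rho> \<sigma> \<le> D (f s) (f t)"
      by (simp add: algebra_simps)
  qed
  have "D (f s) (f t) = \<bar>t - s\<bar> * D (f 0) (f 1)" if "s \<in> {0..1}" "t \<in> {0..1}" for s t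
  proof (cases "s \<le> t")
    case True
    then show ?thesis
      using that eq[of s t] by (simp add: f(1,2))
  next
    case False
    then show ?thesis
      using that eq[of t s] D_sym[of "f s" "f t"] by (simp add: f(1,2))
  qed
  then show "\<exists>x::real \<Rightarrow> 'a \<Rightarrow>\<^sub>L 'a. (\<forall>t\<in>{0..1}. x t \<in> density_ops) \<and> x 0 = \<rho> \<and> x 1 = \<sigma> \<and>
      (\<forall>s\<in>{0..1}. \<forall>t\<in>{0..1}. D (x s) (x t) = \<bar>t - s\<bar> * D (x 0) (x 1))"
    by (intro exI[of _ f] conjI ballI fS f(1,2))
qed

end

section \<open>The Frobenius and Fubini-Study distances\<close>

lemma ground_distance_d_Fr:
  assumes "1 \<le> p"
  shows "ground_distance (d_Fr :: ('a::fd_complex_hilbert \<Rightarrow>\<^sub>L 'a) \<Rightarrow> _) p 1"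
proof
  fix P Q :: "'a \<Rightarrow>\<^sub>L 'a"
  show "d_Fr P Q = d_Fr Q P"
    unfolding d_Fr_def by (subst cinner_commute) simp
  show "1 * hs_norm (P - Q) \<le> d_Fr P Q" if "P \<in> pure_states" "Q \<in> pure_states"
    using that by (simp add: d_Fr_eq_hs_norm)
  show "d_Fr P P = 0" if "P \<in> pure_states"
    using that by (simp add: d_Fr_eq_hs_norm hs_norm_def L2_set_def)
  have "continuous_on (pure_states \<times> pure_states) (\<lambda>z::('a \<Rightarrow>\<^sub>L 'a) \<times> _. hs_norm (fst z - snd z))"
    by (intro continuous_intros)
  then show "continuous_on (pure_states \<times> pure_states) (\<lambda>z::('a \<Rightarrow>\<^sub>L 'a) \<times> _. d_Fr (fst z) (snd z))"
    by (rule continuous_on_eq) (auto simp: d_Fr_eq_hs_norm)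
qed (use assms in auto)

lemma ground_distance_d_FS:
  assumes "1 \<le> p"
  shows "ground_distance (d_FS :: ('a::fd_complex_hilbert \<Rightarrow>\<^sub>L 'a) \<Rightarrow> _) p (2 powr (-1/2))"
proof
  fix P Q :: "'a \<Rightarrow>\<^sub>L 'a"
  show "d_FS P Q = d_FS Q P"
    unfolding d_FS_def by (subst cinner_commute) simp
  show "2 powr (-1/2) * hs_norm (P - Q) \<le> d_FS P Q" if "P \<in> pure_states" "Q \<in> pure_states"
    using that by (rule d_FS_lower)
  show "d_FS P P = 0" if "P \<in> pure_states"
    using that by (simp add: d_FS_eq_hs_norm hs_norm_def L2_set_def)
  have "continuous_on (pure_states \<times> pure_states)
      (\<lambda>z::('a \<Rightarrow>\<^sub>L 'a) \<times> _. arccos (sqrt (1 - (hs_norm (fst z - snd z))\<^sup>2 / 2)))"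
  proof (intro continuous_intros ballI conjI)
    fix z :: "('a \<Rightarrow>\<^sub>L 'a) \<times> ('a \<Rightarrow>\<^sub>L 'a)" assume "z \<in> pure_states \<times> pure_states"
    then have "0 \<le> 1 - (hs_norm (fst z - snd z))\<^sup>2 / 2"
      by (intro d_FS_eq_hs_norm) (auto simp: mem_Times_iff)
    then show "- 1 \<le> sqrt (1 - (hs_norm (fst z - snd z))\<^sup>2 / 2)"
      by (intro order_trans[OF _ real_sqrt_ge_zero]) auto
    show "sqrt (1 - (hs_norm (fst z - snd z))\<^sup>2 / 2) \<le> 1"
      by simp
  qed simp
  then show "continuous_on (pure_states \<times> pure_states) (\<lambda>z::('a \<Rightarrow>\<^sub>L 'a) \<times> _. d_FS (fst z) (snd z))"
    by (rule continuous_on_eq) (auto simp: d_FS_eq_hs_norm)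
qed (use assms in auto)

text \<open>Moving the portion t - s of the mass costs (t - s) * x, which is the required amount
  exactly at the exponent 1; a larger exponent would demand less.\<close>

lemma geodesic_ground_distance_1:
  assumes "ground_distance d 1 c"
  shows "geodesic_ground_distance d 1 c"
proof -
  interpret ground_distance d 1 c by fact
  show ?thesis
  proof
    fix \<rho> \<sigma> :: "'a \<Rightarrow>\<^sub>L 'a" and x assume x: "((\<rho>, \<sigma>), x) \<in> plans"
    then have S: "\<rho> \<in> density_ops" "\<sigma> \<in> density_ops"
      using plans_density by auto
    define f where "f t = (1 - t) *\<^sub>R \<rho> + t *\<^sub>R \<sigma>" for t
    have "((f s, f t), (t - s) powr 1 * x) \<in> plans" if st: "0 \<le> s" "s \<le> t" "t \<le> 1" for s t
    proof -
      \<comment> \<open>Between the times s and t, the share 1 - t still rests at \<rho>, the share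
        t - s travels, and the share s has already arrived at \<sigma>.\<close>
      have "(1 - t) *\<^sub>R ((\<rho>, \<rho>), 0) + (t - s) *\<^sub>R ((\<rho>, \<sigma>), x) + s *\<^sub>R ((\<sigma>, \<sigma>), 0) \<in> plans"
        using st by (intro convex_combination3 plans_convex plans_diag S x) auto
      also have "(1 - t) *\<^sub>R ((\<rho>, \<rho>), 0) + (t - s) *\<^sub>R ((\<rho>, \<sigma>), x) + s *\<^sub>R ((\<sigma>, \<sigma>), 0)
          = ((f s, f t), (t - s) * x)"
        by (simp add: f_def algebra_simps)
      finally show ?thesis
        using st by simp
    qed
    moreover have "f 0 = \<rho>" "f 1 = \<sigma>"
      by (simp_all add: f_def)
    ultimately show "\<exists>f. f 0 = \<rho> \<and> f 1 = \<sigma> \<and>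
        (\<forall>s t. 0 \<le> s \<longrightarrow> s \<le> t \<longrightarrow> t \<le> 1 \<longrightarrow> ((f s, f t), (t - s) powr 1 * x) \<in> plans)"
      by blast
  qed
qed

text \<open>Each atom follows its own geodesic with its weight unchanged. The cost of every atom is
  multiplied by the same (t - s) powr p, so this factor comes out of the sum for any
  exponent.\<close>

lemma geodesic_ground_distance_d_FS:
  assumes p: "1 \<le> p"
  shows "geodesic_ground_distance (d_FS :: ('a::fd_complex_hilbert \<Rightarrow>\<^sub>L 'a) \<Rightarrow> _) p (2 powr (-1/2))"
proof -
  let ?E = "pure_states :: ('a \<Rightarrow>\<^sub>L 'a) set"
  interpret ground_distance "d_FS :: ('a \<Rightarrow>\<^sub>L 'a) \<Rightarrow> _" p "2 powr (-1/2)"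
    using p by (rule ground_distance_d_FS)
  show ?thesis
  proof
    fix \<rho> \<sigma> :: "'a \<Rightarrow>\<^sub>L 'a" and x assume "((\<rho>, \<sigma>), x) \<in> plans"
    then obtain F u where F: "finite F" "F \<subseteq> (\<lambda>z. (z, cost z)) ` (?E \<times> ?E)" "\<forall>x\<in>F. 0 \<le> u x" "sum u F = 1"
      "(\<Sum>v\<in>F. u v *\<^sub>R v) = ((\<rho>, \<sigma>), x)"
      unfolding plans_def convex_hull_explicit by blast
    have "\<exists>\<gamma>. \<gamma> 0 = fst (fst v) \<and> \<gamma> 1 = snd (fst v) \<and> (\<forall>t. \<gamma> t \<in> ?E) \<and>
        (\<forall>s t. 0 \<le> s \<longrightarrow> s \<le> t \<longrightarrow> t \<le> 1 \<longrightarrow> cost (\<gamma> s, \<gamma> t) = (t - s) powr p * snd v)"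
      if "v \<in> F" for v
    proof -
      have v: "fst (fst v) \<in> ?E" "snd (fst v) \<in> ?E" "snd v = cost (fst v)"
        using F(2) that by auto
      obtain \<gamma> where \<gamma>: "\<gamma> 0 = fst (fst v)" "\<gamma> 1 = snd (fst v)" "\<And>t. \<gamma> t \<in> ?E"
        "\<And>s t. s \<in> {0..1} \<Longrightarrow> t \<in> {0..1} \<Longrightarrow> d_FS (\<gamma> s) (\<gamma> t) = \<bar>t - s\<bar> * d_FS (fst (fst v)) (snd (fst v))"
        using d_FS_geodesic[OF v(1,2)] by metis
      have "cost (\<gamma> s, \<gamma> t) = (t - s) powr p * snd v" if "0 \<le> s" "s \<le> t" "t \<le> 1" for s t
        using \<gamma>(4)[of s t] that d_nonneg[OF v(1,2)] by (simp add: v(3) cost_def powr_mult)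
      then show ?thesis
        using \<gamma>(1-3) by blast
    qed
    then obtain \<gamma> where \<gamma>: "\<And>v. v \<in> F \<Longrightarrow> \<gamma> v 0 = fst (fst v)" "\<And>v. v \<in> F \<Longrightarrow> \<gamma> v 1 = snd (fst v)"
      "\<And>v t. v \<in> F \<Longrightarrow> \<gamma> v t \<in> ?E"
      "\<And>v s t. v \<in> F \<Longrightarrow> 0 \<le> s \<Longrightarrow> s \<le> t \<Longrightarrow> t \<le> 1 \<Longrightarrow> cost (\<gamma> v s, \<gamma> v t) = (t - s) powr p * snd v"
      by metis
    define f where "f t = (\<Sum>v\<in>F. u v *\<^sub>R \<gamma> v t)" for t
    have "f 0 = fst (fst (\<Sum>v\<in>F. u v *\<^sub>R v))" "f 1 = snd (fst (\<Sum>v\<in>F. u v *\<^sub>R v))"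
      unfolding f_def fst_sum snd_sum using \<gamma>(1,2) by auto
    then have "f 0 = \<rho>" "f 1 = \<sigma>"
      by (simp_all add: F(5))
    moreover have "((f s, f t), (t - s) powr p * x) \<in> plans" if st: "0 \<le> s" "s \<le> t" "t \<le> 1" for s t
    proof -
      let ?w = "\<lambda>v. ((\<gamma> v s, \<gamma> v t), cost (\<gamma> v s, \<gamma> v t))"
      have "(\<Sum>v\<in>F. u v *\<^sub>R ?w v) \<in> plans"
        using F \<gamma>(3) unfolding plans_def
        by (intro convex_sum convex_convex_hull hull_inc) auto
      moreover have "snd (\<Sum>v\<in>F. u v *\<^sub>R ?w v) = (t - s) powr p * snd (\<Sum>v\<in>F. u v *\<^sub>R v)"
        using \<gamma>(4)[OF _ st] by (simp add: snd_sum sum_distrib_left mult_ac)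
      then have "(\<Sum>v\<in>F. u v *\<^sub>R ?w v) = ((f s, f t), (t - s) powr p * x)"
        by (simp add: prod_eq_iff fst_sum snd_sum f_def F(5))
      ultimately show ?thesis
        by simp
    qed
    ultimately show "\<exists>f. f 0 = \<rho> \<and> f 1 = \<sigma> \<and>
        (\<forall>s t. 0 \<le> s \<longrightarrow> s \<le> t \<longrightarrow> t \<le> 1 \<longrightarrow> ((f s, f t), (t - s) powr p * x) \<in> plans)"
      by blast
  qed
qed

theorem corollary3p6:
  fixes p :: real
  assumes "1 \<le> p"
  shows
    "let S = (density_ops :: ('h::fd_complex_hilbert \<Rightarrow>\<^sub>L 'h) set);
         \<P> = (pure_states :: ('h \<Rightarrow>\<^sub>L 'h) set)
     in
      ((\<forall>\<psi> \<phi> :: 'h. cinner \<psi> \<psi> = 1 \<longrightarrow> cinner \<phi> \<phi> = 1 \<longrightarrow>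
          d_Fr (proj \<psi>) (proj \<phi>) = sqrt 2 * sqrt (1 - (cmod (cinner \<psi> \<phi>))\<^sup>2) \<and>
          d_Fr (proj \<psi>) (proj \<phi>) = frobenius_norm (proj \<psi> - proj \<phi>)) \<and>
       Metric_space S (folded_dist d_Fr p) \<and>
       Metric_space.mtopology S (folded_dist d_Fr p) = top_of_set S \<and>
       (\<forall>P\<in>\<P>. \<forall>Q\<in>\<P>. folded_dist d_Fr p P Q = d_Fr P Q) \<and>
       (\<forall>\<rho>\<in>S. \<forall>\<sigma>\<in>S. folded_dist d_Fr p \<rho> \<sigma> \<ge> frobenius_norm (\<rho> - \<sigma>)) \<and>
       geodesic_space S (folded_dist d_Fr 1))
      \<and>
      ((\<forall>\<psi> \<phi> :: 'h. cinner \<psi> \<psi> = 1 \<longrightarrow> cinner \<phi> \<phi> = 1 \<longrightarrow>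
          d_FS (proj \<psi>) (proj \<phi>) = arccos (cmod (cinner \<psi> \<phi>))) \<and>
       Metric_space S (folded_dist d_FS p) \<and>
       Metric_space.mtopology S (folded_dist d_FS p) = top_of_set S \<and>
       (\<forall>P\<in>\<P>. \<forall>Q\<in>\<P>. folded_dist d_FS p P Q \<le> d_FS P Q) \<and>
       (\<forall>\<rho>\<in>S. \<forall>\<sigma>\<in>S. folded_dist d_FS p \<rho> \<sigma> \<ge> 2 powr (-1/2) * frobenius_norm (\<rho> - \<sigma>)) \<and>
       geodesic_space S (folded_dist d_FS p))"
proof -
  interpret Fr: ground_distance "d_Fr :: ('h \<Rightarrow>\<^sub>L 'h) \<Rightarrow> _" p 1
    using assms by (rule ground_distance_d_Fr)
  \<comment> \<open>The Frobenius geodesic claim concerns the exponent 1, hence a second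
    interpretation of the same distance.\<close>
  interpret Fr1: geodesic_ground_distance "d_Fr :: ('h \<Rightarrow>\<^sub>L 'h) \<Rightarrow> _" 1 1
    by (intro geodesic_ground_distance_1 ground_distance_d_Fr order_refl)
  interpret FS: geodesic_ground_distance "d_FS :: ('h \<Rightarrow>\<^sub>L 'h) \<Rightarrow> _" p "2 powr (-1/2)"
    using assms by (rule geodesic_ground_distance_d_FS)
  have pure: "P \<in> density_ops" if "P \<in> pure_states" for P :: "'h \<Rightarrow>\<^sub>L 'h"
    using that pure_states_subset_density_ops by blast
  show ?thesis
    unfolding Let_def
  proof (intro conjI allI impI ballI Fr.Metric_space_D Fr.mtopology_D Fr1.geodesic_space_D
      FS.Metric_space_D FS.mtopology_D FS.geodesic_space_D FS.D_le_d)
    fix \<psi> \<phi> :: 'h assume "cinner \<psi> \<psi> = 1" "cinner \<phi> \<phi> = 1"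
    then have *: "norm \<psi> = 1" "norm \<phi> = 1"
      by (simp_all add: cinner_self_1_iff)
    show "d_Fr (proj \<psi>) (proj \<phi>) = sqrt 2 * sqrt (1 - (cmod (cinner \<psi> \<phi>))\<^sup>2)"
      by (rule d_Fr_proj[OF *])
    then show "d_Fr (proj \<psi>) (proj \<phi>) = frobenius_norm (proj \<psi> - proj \<phi>)"
      using * by (simp add: frobenius_norm_self_adjoint self_adjoint_diff self_adjoint_proj
          hs_norm_proj_diff)
    show "d_FS (proj \<psi>) (proj \<phi>) = arccos (cmod (cinner \<psi> \<phi>))"
      by (rule d_FS_proj[OF *])
  next
    fix P Q :: "'h \<Rightarrow>\<^sub>L 'h" assume "P \<in> pure_states" "Q \<in> pure_states"
    \<comment> \<open>With c = 1 the lower bound and \<open>D_le_d\<close> meet, both being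
      \<open>hs_norm (P - Q)\<close>.\<close>
    then show "folded_dist d_Fr p P Q = d_Fr P Q"
      using Fr.D_le_d[of P Q] Fr.D_lower[of P Q] by (simp add: pure d_Fr_eq_hs_norm)
  next
    fix \<rho> \<sigma> :: "'h \<Rightarrow>\<^sub>L 'h" assume "\<rho> \<in> density_ops" "\<sigma> \<in> density_ops"
    then show "frobenius_norm (\<rho> - \<sigma>) \<le> folded_dist d_Fr p \<rho> \<sigma>"
      "2 powr (-1/2) * frobenius_norm (\<rho> - \<sigma>) \<le> folded_dist d_FS p \<rho> \<sigma>"
      using Fr.D_lower[of \<rho> \<sigma>] FS.D_lower[of \<rho> \<sigma>] by (simp_all add: frobenius_norm_density_diff)
  qed
qed

end
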